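(* Let $H$ be a Hopf $*$-algebra over $\mathbb{C}$, let $V$ be a $*$-module over $H$, with $*$-structure $*:\overline V\to V$, and let $T(V)$ be the tensor algebra of $V$, with canonical inclusion $\iota_V:V\to T(V)$. There is a unique $*$-module algebra structure $*:\overline{T(V)}\to T(V)$ on $T(V)$ such that $\iota_V$ is a $*$-module morphism, i.e. such that $*\circ\overline{\iota_V}=\iota_V\circ *$ as maps $\overline V\to T(V)$. For $v_1\otimes\dots\otimes v_n\in V^{\otimes n}$ it satisfies $$(\overline{v_1\otimes\dots\otimes v_n})^*=\overline{v_n}^{\,*}\otimes\dots\otimes\overline{v_1}^{\,*}.$$ Hence this $*$-structure on $T(V)$ coincides with the direct sum of the $*$-structures $(\overline{v_1\otimes\dots\otimes v_n})^*=\overline{v_n}^{\,*}\otimes\dots\otimes\overline{v_1}^{\,*}$ on the modules $V^{\otimes n}$.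
   Context: All vector spaces are over $\mathbb{C}$. A Hopf $*$-algebra is a Hopf algebra $H$ over $\mathbb{C}$ (coproduct $\Delta(a)=a_{(1)}\otimes a_{(2)}$, counit $\varepsilon$, antipode $S$) equipped with an antilinear map $*:H\to H$ such that $(a^* )^*=a$, $(ab)^*=b^*a^*$ and $\Delta(a^* )=a_{(1)}^*\otimes a_{(2)}^*$. Modules are left $H$-modules; $\mathbb{C}$ is a module via $\varepsilon$ and tensor products are modules via $a\rhd(v\otimes w)=(a_{(1)}\rhd v)\otimes(a_{(2)}\rhd w)$. For a vector space $V$, the complex conjugate vector space $\overline{V}$ consists of formal symbols $\bar v$ ($v\in V$) with $\bar v+\bar w=\overline{v+w}$ and $\lambda\cdot\bar v=\overline{\bar\lambda v}$. For a linear map $T:V\to W$, $\overline T(\bar v)=\overline{T(v)}$. If $V$ is a left $H$-module, $\overline V$ is a left $H$-module via $a\rhd\bar v=\overline{S(a)^*\rhd v}$. Let $\sigma_V:\overline{\overline V}\to V$, $\bar{\bar v}\mapsto v$. A $*$-structure on an $H$-module $V$ is a module map $*:\overline V\to V$ with $*\circ\overline{*}=\sigma_V$; then $V$ is called a $*$-module, and $*(\bar v)$ is written $\bar v^{\,*}$. A linear map $T:V\to W$ of $*$-modules is a $*$-map if $T\circ *=*\circ\overline T$; a $*$-module morphism is a $*$-map that is also a module map. An algebra in $\mathbf{HMod}$ (an $H$-module algebra) is a unital associative $\mathbb{C}$-algebra $A$ that is an $H$-module such that $a\rhd(xy)=(a_{(1)}\rhd x)(a_{(2)}\rhd y)$ and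 $a\rhd 1_A=\varepsilon(a)1_A$. Its conjugate $\overline A$ is an algebra in $\mathbf{HMod}$ with $\bar x\cdot\bar y=\overline{yx}$ and $1_{\overline A}=\overline{1_A}$. A $*$-module algebra structure (or $*$-algebra structure) on $A$ is a $*$-structure $*:\overline A\to A$ that is also an algebra homomorphism. $T(V)=\bigoplus_{n\ge0}V^{\otimes n}$, with $V^{\otimes0}=\mathbb{C}$, is an algebra in $\mathbf{HMod}$ with concatenation product. The $*$-structure on $V^{\otimes 0}=\mathbb{C}$ is $c_{\mathbb{C}}(\lambda)\mapsto\bar\lambda$, where $c_{\mathbb{C}}:\mathbb{C}\to\overline{\mathbb{C}}$ is the canonical antilinear bijection. A direct sum $\bigoplus_j V_j$ of $*$-modules has the $*$-structure $(\overline{(v_j)_j})^*=(\overline{v_j}^{\,*})_j$. *)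

theory Defs
  imports Complex_Main "HOL-Library.Poly_Mapping"
begin

section \<open>Complex vector spaces and algebras\<close>

class complex_vector = ab_group_add +
  fixes scaleC :: "complex \<Rightarrow> 'a \<Rightarrow> 'a" (infixr \<open>*\<^sub>C\<close> 75)
  assumes scaleC_add_right: "c *\<^sub>C (x + y) = c *\<^sub>C x + c *\<^sub>C y"
    and scaleC_add_left: "(c + d) *\<^sub>C x = c *\<^sub>C x + d *\<^sub>C x"
    and scaleC_scaleC: "c *\<^sub>C d *\<^sub>C x = (c * d) *\<^sub>C x"
    and scaleC_one: "1 *\<^sub>C x = x"

global_interpretation complex_vector: vector_space "scaleC :: complex \<Rightarrow> 'a \<Rightarrow> 'a::complex_vector"
  by unfold_locales (simp_all add: scaleC_add_right scaleC_add_left scaleC_scaleC scaleC_one)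

abbreviation clinear :: "('a::complex_vector \<Rightarrow> 'b::complex_vector) \<Rightarrow> bool" where
  "clinear \<equiv> Vector_Spaces.linear scaleC scaleC"

lemma clinear_iff:
  "clinear f \<longleftrightarrow> (\<forall>x y. f (x + y) = f x + f y) \<and> (\<forall>c x. f (c *\<^sub>C x) = c *\<^sub>C f x)"
  by (auto simp: Vector_Spaces.linear_iff complex_vector.vector_space_axioms)

lemma clinear_add: "clinear f \<Longrightarrow> f (x + y) = f x + f y"
  and clinear_scaleC: "clinear f \<Longrightarrow> f (c *\<^sub>C x) = c *\<^sub>C f x"
  by (simp_all add: clinear_iff)

lemma clinear_zero: "clinear f \<Longrightarrow> f 0 = 0"
  using clinear_iff[of f] complex_vector.scale_zero_left by metis

lemma clinear_diff: "clinear f \<Longrightarrow> f (x - y) = f x - f y"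
  using clinear_iff[of f] by (metis eq_diff_eq)

lemma clinear_sum: "clinear f \<Longrightarrow> f (sum g A) = (\<Sum>a\<in>A. f (g a))"
  by (induction A rule: infinite_finite_induct) (auto simp: clinear_zero clinear_iff)

text \<open>Associative and unital; the zero algebra is allowed, since \<open>0 \<noteq> 1\<close> is not required.\<close>

class complex_algebra = complex_vector + ring + monoid_mult +
  assumes scaleC_mult_left: "c *\<^sub>C x * y = c *\<^sub>C (x * y)"
    and scaleC_mult_right: "x * c *\<^sub>C y = c *\<^sub>C (x * y)"

instantiation complex :: complex_algebra
begin
definition scaleC_complex :: "complex \<Rightarrow> complex \<Rightarrow> complex" where
  "scaleC_complex = (*)"
instance by standard (simp_all add: scaleC_complex_def algebra_simps)
end


section \<open>The complex conjugate of a vector space\<close>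

datatype 'v conjugate = Bar (unbar: 'v)

instantiation conjugate :: (complex_vector) complex_vector
begin
definition "0 = Bar 0"
definition "x + y = Bar (unbar x + unbar y)"
definition "x - y = Bar (unbar x - unbar y)"
definition "- x = Bar (- unbar x)"
definition "c *\<^sub>C x = Bar (cnj c *\<^sub>C unbar x)"
instance
  by standard
    (auto simp: zero_conjugate_def plus_conjugate_def minus_conjugate_def uminus_conjugate_def
      scaleC_conjugate_def scaleC_add_right scaleC_add_left scaleC_scaleC scaleC_one
      intro: conjugate.expand)
end

text \<open>The product is reversed, as required for the conjugate of an algebra in the category of
  modules over a Hopf star-algebra.\<close>

instantiation conjugate :: (complex_algebra) complex_algebra
begin
definition "1 = Bar 1"
definition "x * y = Bar (unbar y * unbar x)"
instance
  by standard
    (auto simp: one_conjugate_def times_conjugate_def plus_conjugate_def scaleC_conjugate_def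
      scaleC_mult_left scaleC_mult_right algebra_simps intro: conjugate.expand)
end

definition conj_map :: "('v \<Rightarrow> 'w) \<Rightarrow> 'v conjugate \<Rightarrow> 'w conjugate" where
  "conj_map T x = Bar (T (unbar x))"

definition unbar2 :: "'v conjugate conjugate \<Rightarrow> 'v" where
  "unbar2 x = unbar (unbar x)"


section \<open>Free vector spaces\<close>

instantiation poly_mapping :: (type, complex_vector) complex_vector
begin
lift_definition scaleC_poly_mapping :: "complex \<Rightarrow> ('a \<Rightarrow>\<^sub>0 'b) \<Rightarrow> 'a \<Rightarrow>\<^sub>0 'b"
  is "\<lambda>c f k. c *\<^sub>C f k"
  by (rule finite_subset[rotated], assumption) auto
instance
  by standard
    (transfer; simp add: fun_eq_iff scaleC_add_right scaleC_add_left scaleC_scaleC scaleC_one)+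
end

lemma scaleC_single: "c *\<^sub>C Poly_Mapping.single k x = Poly_Mapping.single k (c *\<^sub>C x)"
  by transfer (auto simp: fun_eq_iff when_def)

abbreviation gen :: "'a \<Rightarrow> 'a \<Rightarrow>\<^sub>0 complex" where
  "gen x \<equiv> Poly_Mapping.single x 1"

definition free_lift :: "('a \<Rightarrow> 'b::complex_vector) \<Rightarrow> ('a \<Rightarrow>\<^sub>0 complex) \<Rightarrow> 'b" where
  "free_lift f p = (\<Sum>k\<in>Poly_Mapping.keys p. Poly_Mapping.lookup p k *\<^sub>C f k)"

lemma free_lift_superset:
  assumes "finite A" "Poly_Mapping.keys p \<subseteq> A"
  shows "free_lift f p = (\<Sum>k\<in>A. Poly_Mapping.lookup p k *\<^sub>C f k)"
  unfolding free_lift_def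
  by (rule sum.mono_neutral_left) (use assms in \<open>auto simp: in_keys_iff\<close>)

lemma clinear_free_lift: "clinear (free_lift f)"
proof -
  have "free_lift f (p + q) = free_lift f p + free_lift f q" for p q
  proof -
    let ?A = "Poly_Mapping.keys p \<union> Poly_Mapping.keys q"
    have "Poly_Mapping.keys (p + q) \<subseteq> ?A" by (rule keys_add)
    then show ?thesis
      by (simp add: free_lift_superset[of ?A] lookup_add scaleC_add_left sum.distrib)
  qed
  moreover have "free_lift f (c *\<^sub>C p) = c *\<^sub>C free_lift f p" for c p
  proof -
    have "Poly_Mapping.keys (c *\<^sub>C p) \<subseteq> Poly_Mapping.keys p"
      by transfer (auto simp: scaleC_complex_def)
    then have "free_lift f (c *\<^sub>C p)
        = (\<Sum>k\<in>Poly_Mapping.keys p. Poly_Mapping.lookup (c *\<^sub>C p) k *\<^sub>C f k)"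
      by (intro free_lift_superset) auto
    also have "\<dots> = c *\<^sub>C free_lift f p"
      by (simp add: free_lift_def scaleC_poly_mapping.rep_eq scaleC_complex_def
          scaleC_scaleC complex_vector.scale_sum_right)
    finally show ?thesis .
  qed
  ultimately show ?thesis by (simp add: clinear_iff)
qed

lemma free_lift_single: "free_lift f (Poly_Mapping.single k c) = c *\<^sub>C f k"
  by (cases "c = 0") (simp_all add: free_lift_def)

lemma free_lift_fun_add: "free_lift (\<lambda>k. f k + g k) p = free_lift f p + free_lift g p"
  by (simp add: free_lift_def scaleC_add_right sum.distrib)

lemma free_lift_fun_scale: "free_lift (\<lambda>k. c *\<^sub>C f k) p = c *\<^sub>C free_lift f p"
  by (simp add: free_lift_def complex_vector.scale_sum_right scaleC_scaleC mult.commute)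

lemma free_lift_gen: "free_lift f (gen k) = f k"
  by (simp add: free_lift_single scaleC_one)

lemma free_eq_sum_gen:
  "p = (\<Sum>k\<in>Poly_Mapping.keys p. Poly_Mapping.lookup p k *\<^sub>C gen k)"
proof (rule poly_mapping_eqI)
  fix j
  have "Poly_Mapping.lookup (\<Sum>k\<in>Poly_Mapping.keys p. Poly_Mapping.lookup p k *\<^sub>C gen k) j
      = (\<Sum>k\<in>Poly_Mapping.keys p. if k = j then Poly_Mapping.lookup p k else 0)"
    unfolding lookup_sum
    by (intro sum.cong) (auto simp: scaleC_poly_mapping.rep_eq scaleC_complex_def lookup_single)
  also have "\<dots> = Poly_Mapping.lookup p j"
    by (simp add: in_keys_iff)
  finally show "Poly_Mapping.lookup p j
      = Poly_Mapping.lookup (\<Sum>k\<in>Poly_Mapping.keys p. Poly_Mapping.lookup p k *\<^sub>C gen k) j" ..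
qed

lemma sum_closed:
  assumes "P 0" "\<And>x y. P x \<Longrightarrow> P y \<Longrightarrow> P (x + y)" "\<And>k. P (f k)"
  shows "P (sum f A)"
  by (induction A rule: infinite_finite_induct) (use assms in auto)

lemma clinear_vanishes_on_span:
  assumes "clinear f" "\<And>r. r \<in> R \<Longrightarrow> f r = 0" "x \<in> complex_vector.span R"
  shows "f x = 0"
  using assms(3)
  by (induction rule: complex_vector.span_induct_alt)
    (use assms(1,2) in \<open>auto simp: clinear_zero clinear_add clinear_scaleC\<close>)


section \<open>Tensor product of two vector spaces\<close>

text \<open>The quotient of the free vector space on pairs by the bilinearity relations.\<close>

definition tensor_relations :: "('a::complex_vector \<times> 'b::complex_vector \<Rightarrow>\<^sub>0 complex) set" where
  "tensor_relations =
     {gen (a + a', b) - gen (a, b) - gen (a', b) | a a' b. True} \<union>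
     {gen (a, b + b') - gen (a, b) - gen (a, b') | a b b'. True} \<union>
     {gen (c *\<^sub>C a, b) - c *\<^sub>C gen (a, b) | c a b. True} \<union>
     {gen (a, c *\<^sub>C b) - c *\<^sub>C gen (a, b) | c a b. True}"

definition tensor_eq ::
    "('a::complex_vector \<times> 'b::complex_vector \<Rightarrow>\<^sub>0 complex) \<Rightarrow> ('a \<times> 'b \<Rightarrow>\<^sub>0 complex) \<Rightarrow> bool" where
  "tensor_eq x y \<longleftrightarrow> x - y \<in> complex_vector.span tensor_relations"

lemma equivp_diff_in_span:
  "equivp (\<lambda>x y. x - y \<in> complex_vector.span (R :: 'a::complex_vector set))"
proof (rule equivpI)
  show "reflp (\<lambda>x y. x - y \<in> complex_vector.span R)"
    by (simp add: reflp_def complex_vector.span_zero)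
  show "symp (\<lambda>x y. x - y \<in> complex_vector.span R)"
    by (metis (no_types, lifting) complex_vector.span_neg minus_diff_eq sympI)
  show "transp (\<lambda>x y. x - y \<in> complex_vector.span R)"
  proof (rule transpI)
    fix x y z :: 'a
    assume "x - y \<in> complex_vector.span R" "y - z \<in> complex_vector.span R"
    from complex_vector.span_add[OF this] show "x - z \<in> complex_vector.span R" by simp
  qed
qed

quotient_type (overloaded) ('a, 'b) tensor (infixr \<open>\<otimes>\<close> 70) =
    "'a::complex_vector \<times> 'b::complex_vector \<Rightarrow>\<^sub>0 complex" / tensor_eq
  unfolding tensor_eq_def by (rule equivp_diff_in_span)

lemma diff_in_span_add:
  "x - x' \<in> complex_vector.span R \<Longrightarrow> y - y' \<in> complex_vector.span R \<Longrightarrow>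
    (x + y) - (x' + y') \<in> complex_vector.span (R :: 'a::complex_vector set)"
  using complex_vector.span_add by (fastforce simp: add_diff_add)

lemma diff_in_span_scale:
  "x - x' \<in> complex_vector.span R \<Longrightarrow>
    c *\<^sub>C x - c *\<^sub>C x' \<in> complex_vector.span (R :: 'a::complex_vector set)"
  using complex_vector.span_scale by (fastforce simp flip: complex_vector.scale_right_diff_distrib)

lemma diff_in_span_uminus:
  "x - x' \<in> complex_vector.span R \<Longrightarrow> - x - - x' \<in> complex_vector.span (R :: 'a::complex_vector set)"
  using diff_in_span_scale[of x x' R "-1"] by (simp add: complex_vector.scale_minus_left)

lemma diff_in_span_minus:
  "x - x' \<in> complex_vector.span R \<Longrightarrow> y - y' \<in> complex_vector.span R \<Longrightarrow>
    (x - y) - (x' - y') \<in> complex_vector.span (R :: 'a::complex_vector set)"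
  using diff_in_span_add[OF _ diff_in_span_uminus, of x x' R y y'] by simp

instantiation tensor :: (complex_vector, complex_vector) complex_vector
begin
lift_definition zero_tensor :: "'a \<otimes> 'b" is 0 .
lift_definition plus_tensor :: "'a \<otimes> 'b \<Rightarrow> 'a \<otimes> 'b \<Rightarrow> 'a \<otimes> 'b" is "(+)"
  unfolding tensor_eq_def by (rule diff_in_span_add)
lift_definition minus_tensor :: "'a \<otimes> 'b \<Rightarrow> 'a \<otimes> 'b \<Rightarrow> 'a \<otimes> 'b" is "(-)"
  unfolding tensor_eq_def by (rule diff_in_span_minus)
lift_definition uminus_tensor :: "'a \<otimes> 'b \<Rightarrow> 'a \<otimes> 'b" is uminus
  unfolding tensor_eq_def by (rule diff_in_span_uminus)
lift_definition scaleC_tensor :: "complex \<Rightarrow> 'a \<otimes> 'b \<Rightarrow> 'a \<otimes> 'b" is scaleC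
  unfolding tensor_eq_def by (rule diff_in_span_scale)
instance
  by standard
    (transfer; simp add: tensor_eq_def algebra_simps complex_vector.span_zero
      scaleC_add_right scaleC_add_left scaleC_scaleC scaleC_one)+
end

lift_definition tensor :: "'a::complex_vector \<Rightarrow> 'b::complex_vector \<Rightarrow> 'a \<otimes> 'b" (infixr \<open>\<otimes>\<close> 70)
  is "\<lambda>a b. gen (a, b)" .

text \<open>The linear map out of the tensor product induced by \<open>f\<close>; meaningful when \<open>f\<close> is bilinear
  (see \<open>tensor_lift_tensor\<close>).  \<open>tensor_lift f (comult a)\<close> is the Sweedler expression
  \<open>f (a_(1)) (a_(2))\<close>.\<close>

definition tensor_lift ::
    "('a::complex_vector \<Rightarrow> 'b::complex_vector \<Rightarrow> 'c::complex_vector) \<Rightarrow> 'a \<otimes> 'b \<Rightarrow> 'c" where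
  "tensor_lift f t = free_lift (\<lambda>(a, b). f a b) (rep_tensor t)"

definition bilinear_map ::
    "('a::complex_vector \<Rightarrow> 'b::complex_vector \<Rightarrow> 'c::complex_vector) \<Rightarrow> bool" where
  "bilinear_map f \<longleftrightarrow> (\<forall>b. clinear (\<lambda>a. f a b)) \<and> (\<forall>a. clinear (f a))"

lemma bilinear_map_iff:
  "bilinear_map f \<longleftrightarrow>
    (\<forall>a a' b. f (a + a') b = f a b + f a' b) \<and> (\<forall>c a b. f (c *\<^sub>C a) b = c *\<^sub>C f a b) \<and>
    (\<forall>a b b'. f a (b + b') = f a b + f a b') \<and> (\<forall>c a b. f a (c *\<^sub>C b) = c *\<^sub>C f a b)"
  unfolding bilinear_map_def clinear_iff by blast

lemma bilinear_map_tensor: "bilinear_map tensor"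
  unfolding bilinear_map_iff
  by (intro conjI allI; transfer)
    (auto simp: tensor_eq_def tensor_relations_def diff_diff_eq
      intro!: complex_vector.span_base, metis+)

lemma tensor_lift_abs:
  assumes "bilinear_map f"
  shows "tensor_lift f (abs_tensor p) = free_lift (\<lambda>(a, b). f a b) p"
proof -
  let ?F = "free_lift (\<lambda>(a, b). f a b)"
  have "tensor_eq (rep_tensor (abs_tensor p)) p"
    using Quotient3_rep_abs[OF Quotient3_tensor] equivp_reflp[OF tensor_equivp] by blast
  then have *: "rep_tensor (abs_tensor p) - p \<in> complex_vector.span tensor_relations"
    by (simp add: tensor_eq_def)
  have "?F (rep_tensor (abs_tensor p) - p) = 0"
    by (rule clinear_vanishes_on_span[OF clinear_free_lift _ *])
      (use assms in \<open>auto simp: tensor_relations_def clinear_diff[OF clinear_free_lift]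
        free_lift_gen bilinear_map_iff scaleC_single free_lift_single scaleC_complex_def\<close>)
  then show ?thesis
    by (simp add: tensor_lift_def clinear_diff[OF clinear_free_lift])
qed

lemma tensor_lift_tensor: "bilinear_map f \<Longrightarrow> tensor_lift f (a \<otimes> b) = f a b"
  by (simp add: tensor.abs_eq tensor_lift_abs free_lift_gen)

lemma abs_tensor_cases: obtains p where "t = abs_tensor p"
  by (metis Quotient3_abs_rep[OF Quotient3_tensor])

lemma clinear_tensor_lift:
  assumes "bilinear_map f"
  shows "clinear (tensor_lift f)"
proof -
  have "tensor_lift f (x + y) = tensor_lift f x + tensor_lift f y" for x y
    by (cases x rule: abs_tensor_cases; cases y rule: abs_tensor_cases)
      (simp add: plus_tensor.abs_eq tensor_lift_abs[OF assms] clinear_add[OF clinear_free_lift])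
  moreover have "tensor_lift f (c *\<^sub>C x) = c *\<^sub>C tensor_lift f x" for c x
    by (cases x rule: abs_tensor_cases)
      (simp add: scaleC_tensor.abs_eq tensor_lift_abs[OF assms] clinear_scaleC[OF clinear_free_lift])
  ultimately show ?thesis by (simp add: clinear_iff)
qed

lemma clinear_abs_tensor: "clinear abs_tensor"
  by (simp add: clinear_iff plus_tensor.abs_eq scaleC_tensor.abs_eq)

lemma tensor_induct [case_names zero add tensor]:
  assumes "P 0" "\<And>x y. P x \<Longrightarrow> P y \<Longrightarrow> P (x + y)" "\<And>a b. P (a \<otimes> b)"
  shows "P t"
proof (cases t rule: abs_tensor_cases)
  case (1 p)
  have "abs_tensor p
      = (\<Sum>k\<in>Poly_Mapping.keys p. abs_tensor (Poly_Mapping.lookup p k *\<^sub>C gen k))"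
    by (subst (1) free_eq_sum_gen) (rule clinear_sum[OF clinear_abs_tensor])
  also have "\<dots> = (\<Sum>k\<in>Poly_Mapping.keys p. Poly_Mapping.lookup p k *\<^sub>C fst k \<otimes> snd k)"
    using bilinear_map_tensor[where 'a='a and 'b='b]
    by (intro sum.cong) (auto simp: bilinear_map_iff tensor.abs_eq scaleC_tensor.abs_eq)
  also have "P \<dots>"
    by (rule sum_closed) (use assms in auto)
  finally show ?thesis using 1 by simp
qed

lemma clinear_eq_on_tensors:
  assumes "clinear f" "clinear g" "\<And>a b. f (a \<otimes> b) = g (a \<otimes> b)"
  shows "f t = g t"
  by (induction t rule: tensor_induct) (use assms in \<open>auto simp: clinear_zero clinear_iff\<close>)

lemma tensor_lift_fun_add:
  "tensor_lift (\<lambda>a b. f a b + g a b) t = tensor_lift f t + tensor_lift g t"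
  by (simp add: tensor_lift_def free_lift_fun_add case_prod_unfold)

lemma tensor_lift_fun_scale: "tensor_lift (\<lambda>a b. c *\<^sub>C f a b) t = c *\<^sub>C tensor_lift f t"
  by (simp add: tensor_lift_def free_lift_fun_scale case_prod_unfold)

lemma bilinear_map_tensor_lift:
  assumes "\<And>c d. bilinear_map (\<lambda>a b. f a b c d)"
  shows "bilinear_map (\<lambda>a b. tensor_lift (f a b) t)"
proof -
  have "f (a + a') b = (\<lambda>c d. f a b c d + f a' b c d)" "f (k *\<^sub>C a) b = (\<lambda>c d. k *\<^sub>C f a b c d)"
    "f a (b + b') = (\<lambda>c d. f a b c d + f a b' c d)" "f a (k *\<^sub>C b) = (\<lambda>c d. k *\<^sub>C f a b c d)"
    for a a' b b' k
    using assms unfolding bilinear_map_iff fun_eq_iff by blast+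
  then show ?thesis
    by (simp add: bilinear_map_iff tensor_lift_fun_add tensor_lift_fun_scale)
qed

definition tensor_map ::
    "('a::complex_vector \<Rightarrow> 'c::complex_vector) \<Rightarrow> ('b::complex_vector \<Rightarrow> 'd::complex_vector) \<Rightarrow>
      'a \<otimes> 'b \<Rightarrow> 'c \<otimes> 'd" where
  "tensor_map f g = tensor_lift (\<lambda>a b. f a \<otimes> g b)"

definition tensor_assoc ::
    "('a::complex_vector \<otimes> 'b::complex_vector) \<otimes> 'c::complex_vector \<Rightarrow> 'a \<otimes> ('b \<otimes> 'c)" where
  "tensor_assoc = tensor_lift (\<lambda>x c. tensor_lift (\<lambda>a b. a \<otimes> (b \<otimes> c)) x)"

text \<open>The antilinear map \<open>a \<otimes> b \<mapsto> f a \<otimes> g b\<close> for antilinear \<open>f\<close> and \<open>g\<close>; it is obtained from a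
  linear map into the conjugate space.\<close>

definition tensor_antimap ::
    "('a::complex_vector \<Rightarrow> 'c::complex_vector) \<Rightarrow> ('b::complex_vector \<Rightarrow> 'd::complex_vector) \<Rightarrow>
      'a \<otimes> 'b \<Rightarrow> 'c \<otimes> 'd" where
  "tensor_antimap f g t = unbar (tensor_lift (\<lambda>a b. Bar (f a \<otimes> g b)) t)"

definition tensor_times ::
    "'a::complex_algebra \<otimes> 'b::complex_algebra \<Rightarrow> 'a \<otimes> 'b \<Rightarrow> 'a \<otimes> 'b" where
  "tensor_times x y = tensor_lift (\<lambda>a b. tensor_lift (\<lambda>c d. (a * c) \<otimes> (b * d)) y) x"

lemma bilinear_tensor_mult:
  fixes a c :: "'a::complex_algebra" and b d :: "'b::complex_algebra"
  shows "bilinear_map (\<lambda>c d. (a * c) \<otimes> (b * d))" "bilinear_map (\<lambda>a b. (a * c) \<otimes> (b * d))"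
  using bilinear_map_tensor[where 'a='a and 'b='b]
  by (simp_all add: bilinear_map_iff distrib_left distrib_right scaleC_mult_left scaleC_mult_right)

lemma tensor_times_tensor: "tensor_times (a \<otimes> b) (c \<otimes> d) = (a * c) \<otimes> (b * d)"
  by (simp add: tensor_times_def tensor_lift_tensor bilinear_map_tensor_lift bilinear_tensor_mult)

lemma bilinear_tensor_times: "bilinear_map tensor_times"
proof -
  have "clinear (tensor_times x)" for x :: "'a \<otimes> 'b"
    unfolding tensor_times_def clinear_iff
    by (simp add: clinear_add[OF clinear_tensor_lift[OF bilinear_tensor_mult(1)]]
        clinear_scaleC[OF clinear_tensor_lift[OF bilinear_tensor_mult(1)]]
        tensor_lift_fun_add tensor_lift_fun_scale)
  moreover have "clinear (\<lambda>x. tensor_times x y)" for y :: "'a \<otimes> 'b"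
    unfolding tensor_times_def
    by (intro clinear_tensor_lift bilinear_map_tensor_lift bilinear_tensor_mult)
  ultimately show ?thesis by (simp add: bilinear_map_def)
qed

lemma tensor_times_zero: "tensor_times 0 x = 0" "tensor_times x 0 = 0"
  using bilinear_tensor_times clinear_zero[of "tensor_times x"]
    clinear_zero[of "\<lambda>y. tensor_times y x"]
  by (auto simp: bilinear_map_def)

instantiation tensor :: (complex_algebra, complex_algebra) complex_algebra
begin
definition "1 = 1 \<otimes> 1"
definition "x * y = tensor_times x y"
instance
proof
  note bil = bilinear_tensor_times[unfolded bilinear_map_iff, where 'a='a and 'b='b]
  fix x y z :: "'a \<otimes> 'b" and c :: complex
  have assoc: "tensor_times (tensor_times x y) z = tensor_times x (tensor_times y z)"
  proof (induction x rule: tensor_induct)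
    case (tensor a b)
    show ?case
    proof (induction y rule: tensor_induct)
      case (tensor a' b')
      show ?case
        by (induction z rule: tensor_induct)
          (use bil in \<open>auto simp: tensor_times_tensor tensor_times_zero mult.assoc\<close>)
    qed (use bil in \<open>auto simp: tensor_times_zero\<close>)
  qed (use bil in \<open>auto simp: tensor_times_zero\<close>)
  show "x * y * z = x * (y * z)"
    by (simp add: times_tensor_def assoc)
  show "1 * x = x" unfolding times_tensor_def one_tensor_def
    by (induction x rule: tensor_induct)
      (use bil in \<open>auto simp: tensor_times_tensor tensor_times_zero\<close>)
  show "x * 1 = x" unfolding times_tensor_def one_tensor_def
    by (induction x rule: tensor_induct)
      (use bil in \<open>auto simp: tensor_times_tensor tensor_times_zero\<close>)
qed (use bilinear_tensor_times[unfolded bilinear_map_iff, where 'a='a and 'b='b]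
    in \<open>auto simp: times_tensor_def\<close>)
end


section \<open>Hopf star-algebras and their modules\<close>

record (overloaded) ('h::complex_algebra) hopf_data =
  comult :: "'h \<Rightarrow> 'h \<otimes> 'h"
  counit :: "'h \<Rightarrow> complex"
  antipode :: "'h \<Rightarrow> 'h"
  hstar :: "'h \<Rightarrow> 'h"

locale hopf_algebra =
  fixes H :: "'h::complex_algebra hopf_data"
  assumes clinear_comult: "clinear (comult H)"
    and comult_mult: "comult H (a * b) = comult H a * comult H b"
    and comult_one: "comult H 1 = 1"
    and clinear_counit: "clinear (counit H)"
    and counit_mult: "counit H (a * b) = counit H a * counit H b"
    and counit_one: "counit H 1 = 1"
    and comult_coassoc:
      "tensor_assoc (tensor_map (comult H) id (comult H a)) = tensor_map id (comult H) (comult H a)"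
    and counit_left: "tensor_lift (\<lambda>b c. counit H b *\<^sub>C c) (comult H a) = a"
    and counit_right: "tensor_lift (\<lambda>b c. counit H c *\<^sub>C b) (comult H a) = a"
    and clinear_antipode: "clinear (antipode H)"
    and antipode_left: "tensor_lift (\<lambda>b c. antipode H b * c) (comult H a) = counit H a *\<^sub>C 1"
    and antipode_right: "tensor_lift (\<lambda>b c. b * antipode H c) (comult H a) = counit H a *\<^sub>C 1"

locale hopf_star_algebra = hopf_algebra H
  for H :: "'h::complex_algebra hopf_data" +
  assumes hstar_add: "hstar H (a + b) = hstar H a + hstar H b"
    and hstar_scaleC: "hstar H (c *\<^sub>C a) = cnj c *\<^sub>C hstar H a"
    and hstar_hstar: "hstar H (hstar H a) = a"
    and hstar_mult: "hstar H (a * b) = hstar H b * hstar H a"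
    and comult_hstar: "comult H (hstar H a) = tensor_antimap (hstar H) (hstar H) (comult H a)"

locale hmodule =
  fixes act :: "'h::complex_algebra \<Rightarrow> 'v::complex_vector \<Rightarrow> 'v"
  assumes bilinear_act: "bilinear_map act"
    and act_one: "act 1 v = v"
    and act_mult: "act (a * b) v = act a (act b v)"

locale hmodule_algebra = hmodule act
  for H :: "'h::complex_algebra hopf_data" and act :: "'h \<Rightarrow> 'a::complex_algebra \<Rightarrow> 'a" +
  assumes act_times: "act a (x * y) = tensor_lift (\<lambda>b c. act b x * act c y) (comult H a)"
    and act_unit: "act a 1 = counit H a *\<^sub>C 1"

definition module_map ::
    "('h \<Rightarrow> 'v::complex_vector \<Rightarrow> 'v) \<Rightarrow> ('h \<Rightarrow> 'w::complex_vector \<Rightarrow> 'w) \<Rightarrow> ('v \<Rightarrow> 'w) \<Rightarrow> bool" where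
  "module_map act act' T \<longleftrightarrow> clinear T \<and> (\<forall>a v. T (act a v) = act' a (T v))"

definition conj_act ::
    "'h::complex_algebra hopf_data \<Rightarrow> ('h \<Rightarrow> 'v \<Rightarrow> 'v) \<Rightarrow> 'h \<Rightarrow> 'v conjugate \<Rightarrow> 'v conjugate" where
  "conj_act H act a x = Bar (act (hstar H (antipode H a)) (unbar x))"

definition star_structure ::
    "'h::complex_algebra hopf_data \<Rightarrow> ('h \<Rightarrow> 'v::complex_vector \<Rightarrow> 'v) \<Rightarrow>
      ('v conjugate \<Rightarrow> 'v) \<Rightarrow> bool" where
  "star_structure H act star \<longleftrightarrow>
     module_map (conj_act H act) act star \<and> star \<circ> conj_map star = unbar2"

text \<open>A star-structure on a submodule \<open>W\<close>; the values of \<open>star\<close> outside the conjugate of \<open>W\<close> are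
  irrelevant.\<close>

definition star_structure_on ::
    "'v set \<Rightarrow> 'h::complex_algebra hopf_data \<Rightarrow> ('h \<Rightarrow> 'v::complex_vector \<Rightarrow> 'v) \<Rightarrow>
      ('v conjugate \<Rightarrow> 'v) \<Rightarrow> bool" where
  "star_structure_on W H act star \<longleftrightarrow>
     complex_vector.subspace W \<and>
     (\<forall>a. \<forall>w\<in>W. act a w \<in> W) \<and>
     (\<forall>x\<in>Bar ` W. star x \<in> W) \<and>
     (\<forall>x\<in>Bar ` W. \<forall>y\<in>Bar ` W. star (x + y) = star x + star y) \<and>
     (\<forall>c. \<forall>x\<in>Bar ` W. star (c *\<^sub>C x) = c *\<^sub>C star x) \<and>
     (\<forall>a. \<forall>x\<in>Bar ` W. star (conj_act H act a x) = act a (star x)) \<and>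
     (\<forall>x\<in>Bar ` Bar ` W. star (conj_map star x) = unbar2 x)"

locale star_module = hmodule act
  for H :: "'h::complex_algebra hopf_data" and act :: "'h \<Rightarrow> 'v::complex_vector \<Rightarrow> 'v" +
  fixes star :: "'v conjugate \<Rightarrow> 'v"
  assumes star_structure: "star_structure H act star"

locale star_module_algebra = hmodule_algebra H act + star_module H act star
  for H :: "'h::complex_algebra hopf_data" and act :: "'h \<Rightarrow> 'a::complex_algebra \<Rightarrow> 'a"
    and star :: "'a conjugate \<Rightarrow> 'a" +
  assumes star_times: "star (x * y) = star x * star y"
    and star_one: "star 1 = 1"

definition star_map ::
    "('v conjugate \<Rightarrow> 'v) \<Rightarrow> ('w conjugate \<Rightarrow> 'w) \<Rightarrow> ('v \<Rightarrow> 'w) \<Rightarrow> bool" where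
  "star_map star star' T \<longleftrightarrow> T \<circ> star = star' \<circ> conj_map T"

definition star_module_morphism ::
    "('h \<Rightarrow> 'v::complex_vector \<Rightarrow> 'v) \<Rightarrow> ('v conjugate \<Rightarrow> 'v) \<Rightarrow>
      ('h \<Rightarrow> 'w::complex_vector \<Rightarrow> 'w) \<Rightarrow> ('w conjugate \<Rightarrow> 'w) \<Rightarrow> ('v \<Rightarrow> 'w) \<Rightarrow> bool" where
  "star_module_morphism act star act' star' T \<longleftrightarrow> module_map act act' T \<and> star_map star star' T"

lemma star_structure_on_UNIV: "star_structure_on UNIV H act star \<longleftrightarrow> star_structure H act star"
proof -
  have R: "range Bar = UNIV"
    by (auto simp: image_iff) (metis conjugate.collapse)+
  show ?thesis
    unfolding star_structure_on_def star_structure_def module_map_def clinear_iff fun_eq_iff R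
    by (simp add: complex_vector.subspace_UNIV)
qed


section \<open>The tensor algebra\<close>

text \<open>The free vector space on the words \<open>[v\<^sub>1, \<dots>, v\<^sub>n]\<close> of all lengths \<open>n\<close>, modulo multilinearity in
  each letter.  The relations are homogeneous in the length, so this is the direct sum of the tensor
  powers of \<open>V\<close>, which are recovered below as the subspaces \<open>tensor_power n\<close>.\<close>

definition word_relations :: "('v::complex_vector list \<Rightarrow>\<^sub>0 complex) set" where
  "word_relations =
     {gen (us @ (v + w) # ws) - gen (us @ v # ws) - gen (us @ w # ws) | us v w ws. True} \<union>
     {gen (us @ (c *\<^sub>C v) # ws) - c *\<^sub>C gen (us @ v # ws) | us c v ws. True}"

definition word_eq ::
    "('v::complex_vector list \<Rightarrow>\<^sub>0 complex) \<Rightarrow> ('v list \<Rightarrow>\<^sub>0 complex) \<Rightarrow> bool" where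
  "word_eq x y \<longleftrightarrow> x - y \<in> complex_vector.span word_relations"

quotient_type (overloaded) 'v tensor_algebra = "'v::complex_vector list \<Rightarrow>\<^sub>0 complex" / word_eq
  unfolding word_eq_def by (rule equivp_diff_in_span)

instantiation tensor_algebra :: (complex_vector) complex_vector
begin
lift_definition zero_tensor_algebra :: "'a tensor_algebra" is 0 .
lift_definition plus_tensor_algebra ::
    "'a tensor_algebra \<Rightarrow> 'a tensor_algebra \<Rightarrow> 'a tensor_algebra" is "(+)"
  unfolding word_eq_def by (rule diff_in_span_add)
lift_definition minus_tensor_algebra ::
    "'a tensor_algebra \<Rightarrow> 'a tensor_algebra \<Rightarrow> 'a tensor_algebra" is "(-)"
  unfolding word_eq_def by (rule diff_in_span_minus)
lift_definition uminus_tensor_algebra :: "'a tensor_algebra \<Rightarrow> 'a tensor_algebra" is uminus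
  unfolding word_eq_def by (rule diff_in_span_uminus)
lift_definition scaleC_tensor_algebra :: "complex \<Rightarrow> 'a tensor_algebra \<Rightarrow> 'a tensor_algebra" is scaleC
  unfolding word_eq_def by (rule diff_in_span_scale)
instance
  by standard
    (transfer; simp add: word_eq_def algebra_simps complex_vector.span_zero
      scaleC_add_right scaleC_add_left scaleC_scaleC scaleC_one)+
end

text \<open>\<open>pure_tensor [v\<^sub>1, \<dots>, v\<^sub>n]\<close> is \<open>v\<^sub>1 \<otimes> \<dots> \<otimes> v\<^sub>n\<close>.\<close>

lift_definition pure_tensor :: "'v::complex_vector list \<Rightarrow> 'v tensor_algebra" is gen .

text \<open>The linear map out of the tensor algebra induced by \<open>f\<close>; meaningful when \<open>f\<close> is multilinear on
  words (see \<open>tensor_algebra_lift_pure\<close>).\<close>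

definition tensor_algebra_lift ::
    "('v::complex_vector list \<Rightarrow> 'a::complex_vector) \<Rightarrow> 'v tensor_algebra \<Rightarrow> 'a" where
  "tensor_algebra_lift f t = free_lift f (rep_tensor_algebra t)"

definition multilinear :: "('v::complex_vector list \<Rightarrow> 'a::complex_vector) \<Rightarrow> bool" where
  "multilinear f \<longleftrightarrow> (\<forall>us ws. clinear (\<lambda>v. f (us @ v # ws)))"

lemma multilinear_iff:
  "multilinear f \<longleftrightarrow>
    (\<forall>us v w ws. f (us @ (v + w) # ws) = f (us @ v # ws) + f (us @ w # ws)) \<and>
    (\<forall>us c v ws. f (us @ (c *\<^sub>C v) # ws) = c *\<^sub>C f (us @ v # ws))"
  unfolding multilinear_def clinear_iff by blast

lemma multilinear_pure_tensor: "multilinear pure_tensor"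
  unfolding multilinear_iff
  by (intro conjI allI; transfer)
    (auto simp: word_eq_def word_relations_def diff_diff_eq intro!: complex_vector.span_base, metis+)

lemma abs_tensor_algebra_cases: obtains p where "t = abs_tensor_algebra p"
  by (metis Quotient3_abs_rep[OF Quotient3_tensor_algebra])

lemma tensor_algebra_lift_abs:
  assumes "multilinear f"
  shows "tensor_algebra_lift f (abs_tensor_algebra p) = free_lift f p"
proof -
  have "word_eq (rep_tensor_algebra (abs_tensor_algebra p)) p"
    using Quotient3_rep_abs[OF Quotient3_tensor_algebra] equivp_reflp[OF tensor_algebra_equivp]
    by blast
  then have *: "rep_tensor_algebra (abs_tensor_algebra p) - p \<in> complex_vector.span word_relations"
    by (simp add: word_eq_def)
  have "free_lift f (rep_tensor_algebra (abs_tensor_algebra p) - p) = 0"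
    by (rule clinear_vanishes_on_span[OF clinear_free_lift _ *])
      (use assms in \<open>auto simp: word_relations_def clinear_diff[OF clinear_free_lift]
        free_lift_gen multilinear_iff scaleC_single free_lift_single scaleC_complex_def\<close>)
  then show ?thesis
    by (simp add: tensor_algebra_lift_def clinear_diff[OF clinear_free_lift])
qed

lemma tensor_algebra_lift_pure:
  "multilinear f \<Longrightarrow> tensor_algebra_lift f (pure_tensor vs) = f vs"
  by (simp add: pure_tensor.abs_eq tensor_algebra_lift_abs free_lift_gen)

lemma clinear_tensor_algebra_lift:
  assumes "multilinear f"
  shows "clinear (tensor_algebra_lift f)"
proof -
  note lift = tensor_algebra_lift_abs[OF assms] clinear_free_lift[of f, unfolded clinear_iff]
  have "tensor_algebra_lift f (x + y) = tensor_algebra_lift f x + tensor_algebra_lift f y" for x y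
    by (cases x rule: abs_tensor_algebra_cases; cases y rule: abs_tensor_algebra_cases)
      (simp add: plus_tensor_algebra.abs_eq lift)
  moreover have "tensor_algebra_lift f (c *\<^sub>C x) = c *\<^sub>C tensor_algebra_lift f x" for c x
    by (cases x rule: abs_tensor_algebra_cases) (simp add: scaleC_tensor_algebra.abs_eq lift)
  ultimately show ?thesis by (simp add: clinear_iff)
qed

lemma clinear_abs_tensor_algebra: "clinear abs_tensor_algebra"
  by (simp add: clinear_iff plus_tensor_algebra.abs_eq scaleC_tensor_algebra.abs_eq)

lemma tensor_algebra_induct [case_names zero add scale pure]:
  assumes "P 0" "\<And>x y. P x \<Longrightarrow> P y \<Longrightarrow> P (x + y)" "\<And>c x. P x \<Longrightarrow> P (c *\<^sub>C x)"
    and "\<And>vs. P (pure_tensor vs)"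
  shows "P t"
proof (cases t rule: abs_tensor_algebra_cases)
  case (1 p)
  have "abs_tensor_algebra p
      = (\<Sum>k\<in>Poly_Mapping.keys p. abs_tensor_algebra (Poly_Mapping.lookup p k *\<^sub>C gen k))"
    by (subst (1) free_eq_sum_gen) (rule clinear_sum[OF clinear_abs_tensor_algebra])
  also have "\<dots> = (\<Sum>k\<in>Poly_Mapping.keys p. Poly_Mapping.lookup p k *\<^sub>C pure_tensor k)"
    by (simp add: pure_tensor.abs_eq scaleC_tensor_algebra.abs_eq)
  also have "P \<dots>"
    by (rule sum_closed) (use assms in auto)
  finally show ?thesis using 1 by simp
qed

lemma tensor_algebra_lift_fun_add:
  "tensor_algebra_lift (\<lambda>vs. f vs + g vs) t = tensor_algebra_lift f t + tensor_algebra_lift g t"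
  by (simp add: tensor_algebra_lift_def free_lift_fun_add)

lemma tensor_algebra_lift_fun_scale:
  "tensor_algebra_lift (\<lambda>vs. c *\<^sub>C f vs) t = c *\<^sub>C tensor_algebra_lift f t"
  by (simp add: tensor_algebra_lift_def free_lift_fun_scale)

definition concat_times ::
    "'v::complex_vector tensor_algebra \<Rightarrow> 'v tensor_algebra \<Rightarrow> 'v tensor_algebra" where
  "concat_times x y =
     tensor_algebra_lift (\<lambda>us. tensor_algebra_lift (\<lambda>ws. pure_tensor (us @ ws)) y) x"

lemma multilinear_append:
  fixes us ws :: "'v::complex_vector list"
  shows "multilinear (\<lambda>ws. pure_tensor (us @ ws))" "multilinear (\<lambda>us. pure_tensor (us @ ws))"
proof -
  note pure = multilinear_pure_tensor[unfolded multilinear_iff, where 'a='v]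
  show "multilinear (\<lambda>ws. pure_tensor (us @ ws))"
    using pure by (simp add: multilinear_iff flip: append_assoc)
  show "multilinear (\<lambda>us. pure_tensor (us @ ws))"
    using pure by (simp add: multilinear_iff)
qed

lemma multilinear_append_lift:
  "multilinear (\<lambda>us. tensor_algebra_lift (\<lambda>ws. pure_tensor (us @ ws)) y)"
proof -
  have "(\<lambda>xs. pure_tensor ((us @ (v + w) # ws) @ xs))
      = (\<lambda>xs. pure_tensor ((us @ v # ws) @ xs) + pure_tensor ((us @ w # ws) @ xs))"
    "(\<lambda>xs. pure_tensor ((us @ (c *\<^sub>C v) # ws) @ xs)) = (\<lambda>xs. c *\<^sub>C pure_tensor ((us @ v # ws) @ xs))"
    for us ws c and v w :: 'a
    using multilinear_append(2) unfolding multilinear_iff fun_eq_iff by blast+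
  then show ?thesis
    unfolding multilinear_iff
    by (simp del: append_assoc append_Cons
        add: tensor_algebra_lift_fun_add tensor_algebra_lift_fun_scale)
qed

lemma concat_times_pure:
  "concat_times (pure_tensor us) (pure_tensor ws) = pure_tensor (us @ ws)"
  by (simp add: concat_times_def tensor_algebra_lift_pure multilinear_append multilinear_append_lift)

lemma bilinear_concat_times: "bilinear_map concat_times"
proof -
  have "clinear (concat_times x)" for x :: "'a tensor_algebra"
    unfolding concat_times_def clinear_iff
    by (simp add: clinear_add[OF clinear_tensor_algebra_lift[OF multilinear_append(1)]]
        clinear_scaleC[OF clinear_tensor_algebra_lift[OF multilinear_append(1)]]
        tensor_algebra_lift_fun_add tensor_algebra_lift_fun_scale)
  moreover have "clinear (\<lambda>x. concat_times x y)" for y :: "'a tensor_algebra"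
    unfolding concat_times_def by (rule clinear_tensor_algebra_lift[OF multilinear_append_lift])
  ultimately show ?thesis by (simp add: bilinear_map_def)
qed

lemma concat_times_zero: "concat_times 0 x = 0" "concat_times x 0 = 0"
  using bilinear_concat_times clinear_zero[of "concat_times x"]
    clinear_zero[of "\<lambda>y. concat_times y x"]
  by (auto simp: bilinear_map_def)

instantiation tensor_algebra :: (complex_vector) complex_algebra
begin
definition "1 = pure_tensor []"
definition "x * y = concat_times x y"
instance
proof
  note bil = bilinear_concat_times[unfolded bilinear_map_iff, where 'a='a]
  fix x y z :: "'a tensor_algebra" and c :: complex
  have assoc: "concat_times (concat_times x y) z = concat_times x (concat_times y z)"
  proof (induction x rule: tensor_algebra_induct)
    case (pure us)
    show ?case
    proof (induction y rule: tensor_algebra_induct)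
      case (pure vs)
      show ?case
        by (induction z rule: tensor_algebra_induct)
          (use bil in \<open>auto simp: concat_times_pure concat_times_zero\<close>)
    qed (use bil in \<open>auto simp: concat_times_zero\<close>)
  qed (use bil in \<open>auto simp: concat_times_zero\<close>)
  show "x * y * z = x * (y * z)"
    by (simp add: times_tensor_algebra_def assoc)
  show "1 * x = x" unfolding times_tensor_algebra_def one_tensor_algebra_def
    by (induction x rule: tensor_algebra_induct)
      (use bil in \<open>auto simp: concat_times_pure concat_times_zero\<close>)
  show "x * 1 = x" unfolding times_tensor_algebra_def one_tensor_algebra_def
    by (induction x rule: tensor_algebra_induct)
      (use bil in \<open>auto simp: concat_times_pure concat_times_zero\<close>)
qed (use bilinear_concat_times[unfolded bilinear_map_iff, where 'a='a]
    in \<open>auto simp: times_tensor_algebra_def\<close>)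
end

lemma pure_tensor_mult: "pure_tensor us * pure_tensor ws = pure_tensor (us @ ws)"
  by (simp add: times_tensor_algebra_def concat_times_pure)

definition tensor_incl :: "'v::complex_vector \<Rightarrow> 'v tensor_algebra" where
  "tensor_incl v = pure_tensor [v]"

text \<open>Each tensor power is regarded as the tensor product of \<open>V\<close> with the next lower power:
  \<open>a \<rhd> (v \<otimes> w) = (a_(1) \<rhd> v) \<otimes> (a_(2) \<rhd> w)\<close>; the empty word carries the counit action.\<close>

primrec word_act ::
    "'h::complex_algebra hopf_data \<Rightarrow> ('h \<Rightarrow> 'v::complex_vector \<Rightarrow> 'v) \<Rightarrow> 'v list \<Rightarrow> 'h \<Rightarrow>
      'v tensor_algebra" where
  "word_act H act [] a = counit H a *\<^sub>C 1"
| "word_act H act (v # vs) a =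
     tensor_lift (\<lambda>b c. tensor_incl (act b v) * word_act H act vs c) (comult H a)"

definition tensor_algebra_act ::
    "'h::complex_algebra hopf_data \<Rightarrow> ('h \<Rightarrow> 'v::complex_vector \<Rightarrow> 'v) \<Rightarrow> 'h \<Rightarrow>
      'v tensor_algebra \<Rightarrow> 'v tensor_algebra" where
  "tensor_algebra_act H act a = tensor_algebra_lift (\<lambda>vs. word_act H act vs a)"

lemma clinear_incl: "clinear tensor_incl"
  using multilinear_pure_tensor[unfolded multilinear_def, rule_format, of "[]" "[]"]
  by (simp add: tensor_incl_def[abs_def])

lemma clinear_word_act:
  assumes "hopf_algebra H" "hmodule act"
  shows "clinear (word_act H act vs)"
proof (induction vs)
  case Nil
  show ?case
    using hopf_algebra.clinear_counit[OF assms(1)]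
    by (simp add: clinear_iff scaleC_add_left scaleC_scaleC)
      (simp add: scaleC_complex_def flip: scaleC_scaleC)
next
  case (Cons v vs)
  have "bilinear_map (\<lambda>b c. tensor_incl (act b v) * word_act H act vs c)"
    using hmodule.bilinear_act[OF assms(2)]
    by (simp add: bilinear_map_iff clinear_add[OF Cons] clinear_scaleC[OF Cons]
        clinear_add[OF clinear_incl] clinear_scaleC[OF clinear_incl]
        distrib_left distrib_right scaleC_mult_left scaleC_mult_right)
  from clinear_tensor_lift[OF this] show ?case
    using hopf_algebra.clinear_comult[OF assms(1)] by (simp add: clinear_iff)
qed

lemma multilinear_word_act:
  assumes "hmodule act"
  shows "multilinear (\<lambda>vs. word_act H act vs a)"
proof -
  note act = hmodule.bilinear_act[OF assms, unfolded bilinear_map_iff]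
  have "word_act H act (us @ (v + w) # ws) a
      = word_act H act (us @ v # ws) a + word_act H act (us @ w # ws) a" for us v w ws
    by (induction us arbitrary: a)
      (simp_all add: act clinear_add[OF clinear_incl] distrib_left distrib_right
        tensor_lift_fun_add)
  moreover have "word_act H act (us @ (c *\<^sub>C v) # ws) a = c *\<^sub>C word_act H act (us @ v # ws) a"
    for us c v ws
    by (induction us arbitrary: a)
      (simp_all add: act clinear_scaleC[OF clinear_incl] scaleC_mult_left scaleC_mult_right
        tensor_lift_fun_scale)
  ultimately show ?thesis by (simp add: multilinear_iff)
qed

lemma tensor_algebra_act_pure:
  assumes "hmodule act"
  shows "tensor_algebra_act H act a (pure_tensor vs) = word_act H act vs a"
  using multilinear_word_act[OF assms]
  by (simp add: tensor_algebra_act_def tensor_algebra_lift_pure)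


subsection \<open>Grading\<close>

definition tensor_power :: "nat \<Rightarrow> 'v::complex_vector tensor_algebra set" where
  "tensor_power n = complex_vector.span (pure_tensor ` {vs. length vs = n})"

lemma tensor_power_0: "tensor_power 0 = range (\<lambda>c. c *\<^sub>C 1)"
  by (simp add: tensor_power_def one_tensor_algebra_def complex_vector.span_singleton)

lemma tensor_algebra_one_neq_zero: "(1 :: 'v::complex_vector tensor_algebra) \<noteq> 0"
proof
  let ?f = "\<lambda>vs :: 'v list. if vs = [] then 1 else 0 :: complex"
  have *: "multilinear ?f" by (simp add: multilinear_iff)
  assume "(1 :: 'v tensor_algebra) = 0"
  then have "tensor_algebra_lift ?f (pure_tensor []) = tensor_algebra_lift ?f 0"
    by (simp add: one_tensor_algebra_def)
  then show False
    using clinear_zero[OF clinear_tensor_algebra_lift[OF *]] by (simp add: tensor_algebra_lift_pure *)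
qed

lemma inj_tensor_incl: "inj tensor_incl"
proof (rule injI)
  fix v w :: 'a
  let ?f = "\<lambda>vs :: 'a list. if length vs = 1 then hd vs else 0"
  have *: "multilinear ?f" by (simp add: multilinear_iff)
  assume "tensor_incl v = tensor_incl w"
  then have "tensor_algebra_lift ?f (pure_tensor [v]) = tensor_algebra_lift ?f (pure_tensor [w])"
    by (simp add: tensor_incl_def)
  then show "v = w" by (simp only: tensor_algebra_lift_pure[OF *]) simp
qed

definition tensor_component :: "nat \<Rightarrow> 'v::complex_vector tensor_algebra \<Rightarrow> 'v tensor_algebra" where
  "tensor_component n = tensor_algebra_lift (\<lambda>vs. if length vs = n then pure_tensor vs else 0)"

lemma multilinear_component:
  "multilinear (\<lambda>vs. if length vs = n then pure_tensor vs else 0)"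
  unfolding multilinear_iff using multilinear_pure_tensor[unfolded multilinear_iff] by auto

lemma tensor_component_pure:
  "tensor_component n (pure_tensor vs) = (if length vs = n then pure_tensor vs else 0)"
  by (simp add: tensor_component_def tensor_algebra_lift_pure multilinear_component)

lemma clinear_tensor_component: "clinear (tensor_component n)"
  unfolding tensor_component_def by (rule clinear_tensor_algebra_lift[OF multilinear_component])

text \<open>The following lemmas say that the tensor algebra is the direct sum of its subspaces
  \<open>tensor_power n\<close>, with projections \<open>tensor_component n\<close>.\<close>

lemma tensor_component_in_power: "tensor_component n x \<in> tensor_power n"
  unfolding tensor_power_def
  by (induction x rule: tensor_algebra_induct)
    (auto simp: tensor_component_pure clinear_zero[OF clinear_tensor_component]
      clinear_add[OF clinear_tensor_component] clinear_scaleC[OF clinear_tensor_component]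
      intro: complex_vector.span_zero complex_vector.span_add complex_vector.span_scale
        complex_vector.span_base)

lemma tensor_component_power:
  assumes "x \<in> tensor_power m"
  shows "tensor_component n x = (if n = m then x else 0)"
  using assms unfolding tensor_power_def
  by (induction rule: complex_vector.span_induct_alt)
    (auto simp: tensor_component_pure clinear_zero[OF clinear_tensor_component]
      clinear_add[OF clinear_tensor_component] clinear_scaleC[OF clinear_tensor_component])

lemma tensor_component_sum_bound:
  "\<exists>N. \<forall>M\<ge>N. tensor_component M x = 0 \<and> x = (\<Sum>n<M. tensor_component n x)"
proof (induction x rule: tensor_algebra_induct)
  case zero
  then show ?case by (simp add: clinear_zero[OF clinear_tensor_component])
next
  case (add x y)
  then obtain N N' where
    "\<forall>M\<ge>N. tensor_component M x = 0 \<and> x = (\<Sum>n<M. tensor_component n x)"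
    "\<forall>M\<ge>N'. tensor_component M y = 0 \<and> y = (\<Sum>n<M. tensor_component n y)"
    by blast
  then have "\<forall>M\<ge>max N N'. tensor_component M (x + y) = 0
      \<and> x + y = (\<Sum>n<M. tensor_component n (x + y))"
    by (simp add: clinear_add[OF clinear_tensor_component] sum.distrib)
  then show ?case by blast
next
  case (scale c x)
  then show ?case
    by (simp add: clinear_scaleC[OF clinear_tensor_component]
        flip: complex_vector.scale_sum_right) (metis complex_vector.scale_zero_right)
next
  case (pure vs)
  show ?case
    by (intro exI[of _ "Suc (length vs)"]) (auto simp: tensor_component_pure)
qed

lemma finite_tensor_components: "finite {n. tensor_component n x \<noteq> 0}"
proof -
  obtain N where "\<forall>n\<ge>N. tensor_component n x = 0"
    using tensor_component_sum_bound by blast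
  then have "{n. tensor_component n x \<noteq> 0} \<subseteq> {..<N}" by (auto simp: not_le[symmetric])
  then show ?thesis by (rule finite_subset) simp
qed

lemma tensor_components_sum: "x = (\<Sum>n | tensor_component n x \<noteq> 0. tensor_component n x)"
proof -
  obtain N where N: "\<forall>n\<ge>N. tensor_component n x = 0" "x = (\<Sum>n<N. tensor_component n x)"
    using tensor_component_sum_bound[of x] by blast
  have "(\<Sum>n | tensor_component n x \<noteq> 0. tensor_component n x) = (\<Sum>n<N. tensor_component n x)"
    by (rule sum.mono_neutral_left) (use N(1) in \<open>auto simp: not_le[symmetric]\<close>)
  then show ?thesis using N(2) by simp
qed

definition direct_sum_star ::
    "(nat \<Rightarrow> 'v::complex_vector tensor_algebra conjugate \<Rightarrow> 'v tensor_algebra) \<Rightarrow>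
      'v tensor_algebra conjugate \<Rightarrow> 'v tensor_algebra" where
  "direct_sum_star s x =
     (\<Sum>n | tensor_component n (unbar x) \<noteq> 0. s n (Bar (tensor_component n (unbar x))))"

end

theory Submission
  imports Defs
begin

text \<open>
  The tensor algebra is the free algebra on \<open>V\<close>, so an antimultiplicative, antilinear map on it is
  determined by its values on \<open>V\<close>; this forces the star of \<open>v\<^sub>1 \<otimes> \<dots> \<otimes> v\<^sub>n\<close> to be
  \<open>v\<^sub>n\<^sup>* \<otimes> \<dots> \<otimes> v\<^sub>1\<^sup>*\<close> (\<open>star_module_algebra_pure_tensor\<close>).  Conversely this formula is
  antilinear in every letter, hence descends to the tensor algebra (\<open>word_star\<close>), and it is visibly
  antimultiplicative and involutive.

  The point with content is that the map so obtained intertwines the action of \<open>a\<close> with that of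
  \<open>S(a)\<^sup>*\<close> (\<open>word_star_act\<close>).  By induction on the word this reduces to the action on a product, where
  the reversal of the factors has to be matched by a reversal of the coproduct:
  \<open>\<Delta>(S(a)\<^sup>*) = S(a\<^sub>(\<^sub>2\<^sub>))\<^sup>* \<otimes> S(a\<^sub>(\<^sub>1\<^sub>))\<^sup>*\<close>.  The star is comultiplicative by hypothesis, and the antipode
  is anticomultiplicative because \<open>\<Delta> \<circ> S\<close> and \<open>a \<mapsto> S(a\<^sub>(\<^sub>2\<^sub>)) \<otimes> S(a\<^sub>(\<^sub>1\<^sub>))\<close> are both inverse to \<open>\<Delta>\<close> for
  convolution (\<open>comult_antipode\<close>).  On the empty word the same role is played by
  \<open>\<epsilon>(S(a)) = \<epsilon>(a)\<close> and \<open>\<epsilon>(a\<^sup>*) = cnj (\<epsilon>(a))\<close>, the latter by uniqueness of the counit.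

  Finally the action and the star respect word length, so they restrict to the tensor powers, and
  the star is the direct sum of its restrictions by linearity.
\<close>

section \<open>Linearity of Sweedler expressions\<close>

lemma clinearI:
  assumes "\<And>x y. f (x + y) = f x + f y" "\<And>c x. f (c *\<^sub>C x) = c *\<^sub>C f x"
  shows "clinear f"
  using assms by (simp add: clinear_iff)

lemma bilinear_mapI:
  assumes "\<And>b. clinear (\<lambda>a. f a b)" "\<And>a. clinear (\<lambda>b. f a b)"
  shows "bilinear_map f"
  using assms by (simp add: bilinear_map_def)

lemma clinear_ident: "clinear (\<lambda>x. x)"
  by (rule clinearI) simp_all

lemma clinear_compose: "clinear f \<Longrightarrow> clinear g \<Longrightarrow> clinear (\<lambda>x. f (g x))"
  by (simp add: clinear_iff)

lemma clinear_bilinear_left: "bilinear_map m \<Longrightarrow> clinear g \<Longrightarrow> clinear (\<lambda>x. m (g x) y)"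
  by (simp add: bilinear_map_iff clinear_iff)

lemma clinear_bilinear_right: "bilinear_map m \<Longrightarrow> clinear g \<Longrightarrow> clinear (\<lambda>x. m y (g x))"
  by (simp add: bilinear_map_iff clinear_iff)

lemma bilinear_map_times: "bilinear_map ((*) :: 'a::complex_algebra \<Rightarrow> 'a \<Rightarrow> 'a)"
  by (simp add: bilinear_map_iff distrib_left distrib_right scaleC_mult_left scaleC_mult_right)

lemma clinear_scale_left: "clinear f \<Longrightarrow> clinear (\<lambda>x. f x *\<^sub>C y)"
  by (simp add: clinear_iff scaleC_add_left scaleC_scaleC) (simp add: scaleC_complex_def)

lemma clinear_scale_right: "clinear f \<Longrightarrow> clinear (\<lambda>x. c *\<^sub>C f x)"
  by (simp add: clinear_iff scaleC_add_right scaleC_scaleC mult.commute)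

lemma clinear_tensor_lift_fun:
  assumes "\<And>b c. clinear (\<lambda>x. f x b c)"
  shows "clinear (\<lambda>x. tensor_lift (f x) t)"
proof (rule clinearI)
  show "tensor_lift (f (x + y)) t = tensor_lift (f x) t + tensor_lift (f y) t" for x y
  proof -
    have "f (x + y) = (\<lambda>b c. f x b c + f y b c)"
      using assms by (simp add: clinear_iff fun_eq_iff)
    then show ?thesis by (simp add: tensor_lift_fun_add)
  qed
  show "tensor_lift (f (c *\<^sub>C x)) t = c *\<^sub>C tensor_lift (f x) t" for c x
  proof -
    have "f (c *\<^sub>C x) = (\<lambda>b d. c *\<^sub>C f x b d)"
      using assms by (simp add: clinear_iff fun_eq_iff)
    then show ?thesis by (simp add: tensor_lift_fun_scale)
  qed
qed

lemmas clinear_intros = bilinear_mapI clinear_ident clinear_tensor_lift_fun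
  clinear_compose[OF clinear_tensor_lift]
  clinear_bilinear_left[OF bilinear_map_times] clinear_bilinear_right[OF bilinear_map_times]
  clinear_bilinear_left[OF bilinear_map_tensor] clinear_bilinear_right[OF bilinear_map_tensor]
  clinear_compose[OF clinear_incl] clinear_scale_left clinear_scale_right

text \<open>Every value of \<open>tensor_lift f\<close> is a finite linear combination of values of \<open>f\<close>; linear maps and
  other such combinations can therefore be moved through it.\<close>

lemma clinear_tensor_lift_commute:
  assumes "clinear g"
  shows "g (tensor_lift f t) = tensor_lift (\<lambda>b c. g (f b c)) t"
  using assms
  by (simp add: tensor_lift_def free_lift_def clinear_sum case_prod_unfold clinear_scaleC)

lemmas times_tensor_lift =
  clinear_tensor_lift_commute[OF clinear_bilinear_right[OF bilinear_map_times clinear_ident]]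
lemmas tensor_lift_times =
  clinear_tensor_lift_commute[OF clinear_bilinear_left[OF bilinear_map_times clinear_ident]]

lemma tensor_lift_swap:
  "tensor_lift (\<lambda>a b. tensor_lift (f a b) y) x
    = tensor_lift (\<lambda>c d. tensor_lift (\<lambda>a b. f a b c d) x) y"
  unfolding tensor_lift_def free_lift_def case_prod_unfold complex_vector.scale_sum_right
  by (subst sum.swap) (simp add: scaleC_scaleC mult.commute)

lemma tensor_lift_in_subspace:
  assumes "complex_vector.subspace W" "\<And>b c. f b c \<in> W"
  shows "tensor_lift f t \<in> W"
  unfolding tensor_lift_def free_lift_def case_prod_unfold
  by (intro complex_vector.subspace_sum complex_vector.subspace_scale assms)

lemma tensor_lift_mult:
  assumes "bilinear_map f"
  shows "tensor_lift f (x * y) = tensor_lift (\<lambda>a b. tensor_lift (\<lambda>c d. f (a * c) (b * d)) y) x"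
proof -
  have "tensor_lift f (x * y)
      = tensor_lift f (tensor_lift (\<lambda>a b. tensor_lift (\<lambda>c d. (a * c) \<otimes> (b * d)) y) x)"
    by (simp add: times_tensor_def tensor_times_def)
  also have "\<dots> = tensor_lift (\<lambda>a b. tensor_lift (\<lambda>c d. f (a * c) (b * d)) y) x"
    by (simp add: clinear_tensor_lift_commute[OF clinear_tensor_lift[OF assms]]
        tensor_lift_tensor[OF assms])
  finally show ?thesis .
qed

section \<open>The coproduct of the antipode and of the star\<close>

context hopf_algebra
begin

lemmas hopf_intros = clinear_intros clinear_compose[OF clinear_comult]
  clinear_compose[OF clinear_antipode] clinear_compose[OF clinear_counit]

text \<open>Coassociativity as it is used with Sweedler notation: a trilinear expression in
  \<open>a\<^sub>(\<^sub>1\<^sub>)\<close>, \<open>a\<^sub>(\<^sub>2\<^sub>)\<close>, \<open>a\<^sub>(\<^sub>3\<^sub>)\<close> has one meaning.\<close>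

lemma tensor_lift_coassoc:
  assumes F: "\<And>c d. clinear (\<lambda>b. F b c d)" "\<And>b d. clinear (\<lambda>c. F b c d)" "\<And>b c. clinear (F b c)"
  shows "tensor_lift (\<lambda>x d. tensor_lift (\<lambda>b c. F b c d) (comult H x)) (comult H a)
    = tensor_lift (\<lambda>b x. tensor_lift (F b) (comult H x)) (comult H a)"
proof -
  define L where "L = tensor_lift (\<lambda>b. tensor_lift (F b))"
  have bil: "bilinear_map (F b)" for b
    by (intro clinear_intros F)
  have bil2: "bilinear_map (\<lambda>b. tensor_lift (F b))"
    by (intro clinear_intros F)
  have L: "clinear L" unfolding L_def by (rule clinear_tensor_lift[OF bil2])
  have L_tensor: "L (b \<otimes> x) = tensor_lift (F b) x" for b x
    unfolding L_def by (rule tensor_lift_tensor[OF bil2])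
  have assoc_bil: "bilinear_map (\<lambda>x c. tensor_lift (\<lambda>a b. a \<otimes> (b \<otimes> c)) x)"
    by (intro clinear_intros)
  have "L (tensor_assoc (tensor_map (comult H) id t))
      = tensor_lift (\<lambda>x d. tensor_lift (\<lambda>b c. F b c d) (comult H x)) t" for t
    unfolding tensor_map_def tensor_assoc_def
    by (simp add: clinear_tensor_lift_commute[OF clinear_tensor_lift[OF assoc_bil]]
        clinear_tensor_lift_commute[OF L] tensor_lift_tensor[OF assoc_bil] L_tensor
        tensor_lift_tensor[OF bil])
  moreover have "L (tensor_map id (comult H) t)
      = tensor_lift (\<lambda>b x. tensor_lift (F b) (comult H x)) t" for t
    unfolding tensor_map_def by (simp add: clinear_tensor_lift_commute[OF L] L_tensor)
  ultimately show ?thesis using comult_coassoc by metis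
qed

lemma clinear_counit_left:
  assumes "clinear f"
  shows "tensor_lift (\<lambda>b c. counit H b *\<^sub>C f c) (comult H a) = f a"
proof -
  have "f a = f (tensor_lift (\<lambda>b c. counit H b *\<^sub>C c) (comult H a))" by (simp add: counit_left)
  then show ?thesis by (simp add: clinear_tensor_lift_commute[OF assms] clinear_scaleC[OF assms])
qed

lemma clinear_counit_right:
  assumes "clinear f"
  shows "tensor_lift (\<lambda>b c. counit H c *\<^sub>C f b) (comult H a) = f a"
proof -
  have "f a = f (tensor_lift (\<lambda>b c. counit H c *\<^sub>C b) (comult H a))" by (simp add: counit_right)
  then show ?thesis by (simp add: clinear_tensor_lift_commute[OF assms] clinear_scaleC[OF assms])
qed

text \<open>The convolution product of \<open>f\<close> and \<open>g\<close> is \<open>a \<mapsto> f(a\<^sub>(\<^sub>1\<^sub>)) g(a\<^sub>(\<^sub>2\<^sub>))\<close>, with unit \<open>a \<mapsto> \<epsilon>(a) 1\<close>;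
  it is associative, so a left and a right inverse of \<open>g\<close> agree.\<close>

lemma convolution_inverse_unique:
  fixes f g k :: "'h \<Rightarrow> 'a::complex_algebra"
  assumes lin: "clinear f" "clinear g" "clinear k"
    and left: "\<And>a. tensor_lift (\<lambda>b c. f b * g c) (comult H a) = counit H a *\<^sub>C 1"
    and right: "\<And>a. tensor_lift (\<lambda>b c. g b * k c) (comult H a) = counit H a *\<^sub>C 1"
  shows "f a = k a"
proof -
  have "f a = tensor_lift (\<lambda>b x. f b * tensor_lift (\<lambda>c d. g c * k d) (comult H x)) (comult H a)"
    by (simp add: right scaleC_mult_right clinear_counit_right[OF lin(1)])
  also have "\<dots> = tensor_lift (\<lambda>b x. tensor_lift (\<lambda>c d. f b * g c * k d) (comult H x)) (comult H a)"
    by (simp add: times_tensor_lift mult.assoc)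
  also have "\<dots> = tensor_lift (\<lambda>x d. tensor_lift (\<lambda>b c. f b * g c * k d) (comult H x)) (comult H a)"
    by (rule tensor_lift_coassoc[symmetric])
      (intro hopf_intros clinear_compose[OF lin(1)] clinear_compose[OF lin(2)] lin)+
  also have "\<dots> = tensor_lift (\<lambda>x d. tensor_lift (\<lambda>b c. f b * g c) (comult H x) * k d) (comult H a)"
    by (simp add: tensor_lift_times)
  also have "\<dots> = k a"
    by (simp add: left scaleC_mult_left clinear_counit_left[OF lin(3)])
  finally show ?thesis .
qed

text \<open>Both sides are inverse to \<open>\<Delta>\<close> for convolution: the left one because \<open>\<Delta>\<close> is multiplicative,
  the right one because in
  \<open>a\<^sub>(\<^sub>1\<^sub>) S(a\<^sub>(\<^sub>4\<^sub>)) \<otimes> a\<^sub>(\<^sub>2\<^sub>) S(a\<^sub>(\<^sub>3\<^sub>))\<close> the inner two factors cancel first.\<close>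

lemma comult_antipode:
  "comult H (antipode H a) = tensor_lift (\<lambda>b c. antipode H c \<otimes> antipode H b) (comult H a)"
proof (rule convolution_inverse_unique[where g = "comult H"])
  let ?S = "antipode H" and ?D = "comult H"
  have bil: "bilinear_map (\<lambda>b c. ?S c \<otimes> ?S b)"
    by (intro hopf_intros)
  show "clinear (\<lambda>a. ?D (?S a))" "clinear ?D"
    "clinear (\<lambda>a. tensor_lift (\<lambda>b c. ?S c \<otimes> ?S b) (?D a))"
    by (intro hopf_intros clinear_comult)+
  show "tensor_lift (\<lambda>b c. ?D (?S b) * ?D c) (?D a) = counit H a *\<^sub>C 1" for a
  proof -
    have "tensor_lift (\<lambda>b c. ?D (?S b) * ?D c) (?D a) = ?D (tensor_lift (\<lambda>b c. ?S b * c) (?D a))"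
      by (simp add: clinear_tensor_lift_commute[OF clinear_comult] comult_mult)
    then show ?thesis
      by (simp add: antipode_left clinear_scaleC[OF clinear_comult] comult_one)
  qed
  show "tensor_lift (\<lambda>b c. ?D b * tensor_lift (\<lambda>b c. ?S c \<otimes> ?S b) (?D c)) (?D a)
      = counit H a *\<^sub>C 1" for a
  proof -
    \<comment> \<open>In Sweedler notation \<open>G b c a = b S(a\<^sub>(\<^sub>2\<^sub>)) \<otimes> c S(a\<^sub>(\<^sub>1\<^sub>))\<close>.  The convolution product is
      \<open>G a\<^sub>(\<^sub>1\<^sub>) a\<^sub>(\<^sub>2\<^sub>) a\<^sub>(\<^sub>3\<^sub>)\<close>, and coassociativity lets \<open>c = a\<^sub>(\<^sub>2\<^sub>)\<close> be grouped with the factor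
      \<open>S(a\<^sub>(\<^sub>3\<^sub>))\<close> that it meets.\<close>
    define G where "G b c x = tensor_lift (\<lambda>d e. (b * ?S e) \<otimes> (c * ?S d)) (?D x)" for b c x
    have G: "clinear (\<lambda>b. G b c x)" "clinear (\<lambda>c. G b c x)" "clinear (G b c)" for b c x
      unfolding G_def by (intro hopf_intros)+
    have times: "y * tensor_lift (\<lambda>d e. ?S e \<otimes> ?S d) (?D c)
        = tensor_lift (\<lambda>a b. G a b c) y" for y c
    proof (rule clinear_eq_on_tensors[where f = "\<lambda>y. y * tensor_lift (\<lambda>d e. ?S e \<otimes> ?S d) (?D c)"])
      show "clinear (\<lambda>y. y * tensor_lift (\<lambda>d e. ?S e \<otimes> ?S d) (?D c))"
        "clinear (tensor_lift (\<lambda>a b. G a b c))"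
        by (intro hopf_intros clinear_tensor_lift G)+
      fix a b :: 'h
      have GB: "bilinear_map (\<lambda>a b. G a b c)" by (intro bilinear_mapI G)
      show "(a \<otimes> b) * tensor_lift (\<lambda>d e. ?S e \<otimes> ?S d) (?D c) = tensor_lift (\<lambda>a b. G a b c) (a \<otimes> b)"
        unfolding tensor_lift_tensor[OF GB] times_tensor_lift
        by (simp add: G_def times_tensor_def tensor_times_tensor)
    qed
    have inner: "tensor_lift (\<lambda>c x. G b c x) (?D y) = (b * ?S y) \<otimes> 1" for b y
    proof -
      have "tensor_lift (\<lambda>c x. G b c x) (?D y)
          = tensor_lift (\<lambda>z e. tensor_lift (\<lambda>c d. (b * ?S e) \<otimes> (c * ?S d)) (?D z)) (?D y)"
        unfolding G_def by (rule tensor_lift_coassoc[symmetric]) (intro hopf_intros)+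
      also have "\<dots> = tensor_lift (\<lambda>z e. (b * ?S e) \<otimes> (counit H z *\<^sub>C 1)) (?D y)"
        by (simp add: antipode_right flip:
            clinear_tensor_lift_commute[OF clinear_bilinear_right[OF bilinear_map_tensor clinear_ident]])
      also have "\<dots> = tensor_lift (\<lambda>z e. counit H z *\<^sub>C ((b * ?S e) \<otimes> 1)) (?D y)"
        using bilinear_map_tensor unfolding bilinear_map_iff by metis
      also have "\<dots> = (b * ?S y) \<otimes> 1"
        by (rule clinear_counit_left) (intro hopf_intros)
      finally show ?thesis .
    qed
    have "tensor_lift (\<lambda>b c. ?D b * tensor_lift (\<lambda>b c. ?S c \<otimes> ?S b) (?D c)) (?D a)
        = tensor_lift (\<lambda>x d. tensor_lift (\<lambda>b c. G b c d) (?D x)) (?D a)"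
      by (simp add: times)
    also have "\<dots> = tensor_lift (\<lambda>b y. tensor_lift (G b) (?D y)) (?D a)"
      by (rule tensor_lift_coassoc[OF G])
    also have "\<dots> = tensor_lift (\<lambda>b y. (b * ?S y) \<otimes> 1) (?D a)"
      by (simp add: inner)
    also have "\<dots> = (counit H a *\<^sub>C 1) \<otimes> 1"
      by (simp add: antipode_right flip:
          clinear_tensor_lift_commute[OF clinear_bilinear_left[OF bilinear_map_tensor clinear_ident]])
    also have "\<dots> = counit H a *\<^sub>C 1"
      using bilinear_map_tensor unfolding bilinear_map_iff one_tensor_def by metis
    finally show ?thesis .
  qed
qed

lemma counit_antipode: "counit H (antipode H a) = counit H a"
proof -
  have "counit H a = counit H (tensor_lift (\<lambda>b c. antipode H b * c) (comult H a))"
    by (simp add: antipode_left clinear_scaleC[OF clinear_counit] counit_one)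
       (simp add: scaleC_complex_def)
  also have "\<dots> = tensor_lift (\<lambda>b c. counit H c *\<^sub>C counit H (antipode H b)) (comult H a)"
    by (simp add: clinear_tensor_lift_commute[OF clinear_counit] counit_mult)
      (simp add: scaleC_complex_def mult.commute)
  also have "\<dots> = counit H (antipode H a)"
    by (rule clinear_counit_right) (intro hopf_intros)
  finally show ?thesis ..
qed

end

context hopf_star_algebra
begin

lemma clinear_hstar: "clinear (\<lambda>a. hstar H (unbar a))"
  by (rule clinearI; simp add: plus_conjugate_def scaleC_conjugate_def hstar_add hstar_scaleC)

lemma tensor_lift_comult_hstar:
  assumes "bilinear_map f"
  shows "tensor_lift f (comult H (hstar H a))
    = unbar (tensor_lift (\<lambda>b c. Bar (f (hstar H b) (hstar H c))) (comult H a))"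
proof -
  have lin: "clinear (\<lambda>t. Bar (tensor_lift f (unbar t)))"
    using clinear_tensor_lift[OF assms]
    by (simp add: clinear_iff plus_conjugate_def scaleC_conjugate_def)
  show ?thesis
    using clinear_tensor_lift_commute[OF lin, of "\<lambda>b c. Bar (hstar H b \<otimes> hstar H c)" "comult H a"]
    by (simp add: comult_hstar tensor_antimap_def tensor_lift_tensor[OF assms])
      (metis conjugate.sel)
qed

text \<open>The functional \<open>a \<mapsto> cnj (\<epsilon>(a\<^sup>*))\<close> is a left counit because the star is comultiplicative, and a
  left counit agrees with the right counit \<open>\<epsilon>\<close>.\<close>

lemma counit_hstar: "counit H (hstar H a) = cnj (counit H a)"
proof -
  define e where "e a = cnj (counit H (hstar H a))" for a
  have e: "clinear e"
    using clinear_counit unfolding clinear_iff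
    by (simp add: e_def hstar_add hstar_scaleC) (simp add: scaleC_complex_def)
  have e_left: "tensor_lift (\<lambda>b c. e b *\<^sub>C c) (comult H a) = a" for a
  proof -
    have bil: "bilinear_map (\<lambda>b c. counit H b *\<^sub>C c)"
      by (intro hopf_intros)
    have "a = hstar H (tensor_lift (\<lambda>b c. counit H b *\<^sub>C c) (comult H (hstar H a)))"
      by (simp add: counit_left hstar_hstar)
    also have "\<dots> = tensor_lift (\<lambda>b c. e b *\<^sub>C c) (comult H a)"
      unfolding tensor_lift_comult_hstar[OF bil] clinear_tensor_lift_commute[OF clinear_hstar]
      by (simp add: e_def hstar_scaleC hstar_hstar)
    finally show ?thesis ..
  qed
  have "counit H a = tensor_lift (\<lambda>b c. e b *\<^sub>C counit H c) (comult H a)"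
    using clinear_tensor_lift_commute[OF clinear_counit, of "\<lambda>b c. e b *\<^sub>C c" "comult H a"]
    by (simp add: e_left clinear_scaleC[OF clinear_counit])
  also have "\<dots> = tensor_lift (\<lambda>b c. counit H c *\<^sub>C e b) (comult H a)"
    by (simp add: scaleC_complex_def mult.commute)
  also have "\<dots> = e a" by (rule clinear_counit_right[OF e])
  finally show ?thesis by (simp add: e_def)
qed

text \<open>Of the star and the antipode only the latter reverses the coproduct, so the composite does; this
  is the reversal that matches the reversed product of a conjugate algebra.\<close>

lemma tensor_lift_comult_hstar_antipode:
  assumes "bilinear_map f"
  shows "tensor_lift f (comult H (hstar H (antipode H a)))
    = unbar (tensor_lift (\<lambda>b c. Bar (f (hstar H (antipode H c)) (hstar H (antipode H b))))
        (comult H a))"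
proof -
  have bil: "bilinear_map (\<lambda>b c. Bar (f (hstar H b) (hstar H c)))"
    using assms
    by (simp add: bilinear_map_iff plus_conjugate_def scaleC_conjugate_def hstar_add hstar_scaleC)
  show ?thesis
    unfolding tensor_lift_comult_hstar[OF assms] comult_antipode
      clinear_tensor_lift_commute[OF clinear_tensor_lift[OF bil]]
    by (simp add: tensor_lift_tensor[OF bil])
qed

end

section \<open>The tensor algebra as a module algebra\<close>

lemma clinear_eq_on_pure_tensors:
  assumes "clinear f" "clinear g" "\<And>vs. f (pure_tensor vs) = g (pure_tensor vs)"
  shows "f x = g x"
  by (induction x rule: tensor_algebra_induct) (use assms in \<open>auto simp: clinear_zero clinear_iff\<close>)

lemma pure_tensor_Cons: "pure_tensor (v # vs) = tensor_incl v * pure_tensor vs"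
  by (simp add: tensor_incl_def pure_tensor_mult)

lemma clinear_tensor_algebra_act:
  assumes "hmodule act"
  shows "clinear (tensor_algebra_act H act a)"
  unfolding tensor_algebra_act_def by (rule clinear_tensor_algebra_lift[OF multilinear_word_act[OF assms]])

context hopf_algebra
begin

lemma bilinear_tensor_algebra_act:
  assumes "hmodule act"
  shows "bilinear_map (tensor_algebra_act H act)"
proof (rule bilinear_mapI)
  note word = clinear_word_act[OF hopf_algebra_axioms assms, unfolded clinear_iff]
  show "clinear (\<lambda>a. tensor_algebra_act H act a x)" for x
  proof (rule clinearI)
    show "tensor_algebra_act H act (a + b) x
        = tensor_algebra_act H act a x + tensor_algebra_act H act b x" for a b
      using word by (simp add: tensor_algebra_act_def flip: tensor_algebra_lift_fun_add)
    show "tensor_algebra_act H act (c *\<^sub>C a) x = c *\<^sub>C tensor_algebra_act H act a x" for c a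
      using word by (simp add: tensor_algebra_act_def flip: tensor_algebra_lift_fun_scale)
  qed
qed (rule clinear_tensor_algebra_act[OF assms])

lemma tensor_algebra_act_incl:
  assumes "hmodule act"
  shows "tensor_algebra_act H act a (tensor_incl v) = tensor_incl (act a v)"
proof -
  have "clinear (\<lambda>b. tensor_incl (act b v))"
    by (intro clinear_intros clinear_bilinear_left[OF hmodule.bilinear_act[OF assms]])
  from clinear_counit_right[OF this] show ?thesis
    by (simp add: tensor_incl_def[of v] tensor_algebra_act_pure[OF assms] scaleC_mult_right)
qed

text \<open>The action on a word is defined by splitting off its first letter; coassociativity makes it
  compatible with every splitting.\<close>

lemma word_act_append:
  assumes "hmodule act"
  shows "word_act H act (us @ vs) a
    = tensor_lift (\<lambda>b c. word_act H act us b * word_act H act vs c) (comult H a)"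
proof (induction us arbitrary: a)
  case Nil
  then show ?case
    by (simp add: scaleC_mult_left clinear_counit_left[OF clinear_word_act[OF hopf_algebra_axioms assms]])
next
  case (Cons u us)
  let ?w = "word_act H act"
  note lin = clinear_compose[OF clinear_word_act[OF hopf_algebra_axioms assms]]
    clinear_bilinear_left[OF hmodule.bilinear_act[OF assms]]
  have "?w ((u # us) @ vs) a
      = tensor_lift (\<lambda>b x. tensor_lift (\<lambda>c d. tensor_incl (act b u) * (?w us c * ?w vs d)) (comult H x))
          (comult H a)"
    by (simp add: Cons times_tensor_lift)
  also have "\<dots>
      = tensor_lift (\<lambda>x d. tensor_lift (\<lambda>b c. tensor_incl (act b u) * (?w us c * ?w vs d)) (comult H x))
          (comult H a)"
    by (rule tensor_lift_coassoc[symmetric]) (intro hopf_intros lin)+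
  also have "\<dots> = tensor_lift (\<lambda>x d. ?w (u # us) x * ?w vs d) (comult H a)"
    by (simp add: mult.assoc tensor_lift_times)
  finally show ?case .
qed

lemma tensor_algebra_act_times:
  assumes "hmodule act"
  shows "tensor_algebra_act H act a (x * y)
    = tensor_lift (\<lambda>b c. tensor_algebra_act H act b x * tensor_algebra_act H act c y) (comult H a)"
    (is "?T a (x * y) = ?R x y")
proof (rule clinear_eq_on_pure_tensors[where f = "\<lambda>x. ?T a (x * y)" and g = "\<lambda>x. ?R x y"])
  note lin = clinear_compose[OF clinear_tensor_algebra_act[OF assms]]
  show "clinear (\<lambda>x. ?T a (x * y))" "clinear (\<lambda>x. ?R x y)"
    by (intro clinear_intros lin)+
  fix us
  show "?T a (pure_tensor us * y) = ?R (pure_tensor us) y"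
  proof (rule clinear_eq_on_pure_tensors[where f = "\<lambda>y. ?T a (pure_tensor us * y)"])
    show "clinear (\<lambda>y. ?T a (pure_tensor us * y))" "clinear (\<lambda>y. ?R (pure_tensor us) y)"
      by (intro clinear_intros lin)+
    show "?T a (pure_tensor us * pure_tensor vs) = ?R (pure_tensor us) (pure_tensor vs)" for vs
      by (simp add: pure_tensor_mult tensor_algebra_act_pure[OF assms] word_act_append[OF assms])
  qed
qed

lemma hmodule_algebra_tensor_algebra:
  assumes "hmodule act"
  shows "hmodule_algebra H (tensor_algebra_act H act)"
proof -
  let ?T = "tensor_algebra_act H act" and ?w = "word_act H act"
  note pure = tensor_algebra_act_pure[OF assms]
  note lin = clinear_tensor_algebra_act[OF assms]
  note act = hmodule.bilinear_act[OF assms]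
  note word_lin = clinear_compose[OF clinear_word_act[OF hopf_algebra_axioms assms]]
  have bil: "bilinear_map (\<lambda>b c. tensor_incl (act b v) * ?w vs c)" for v vs
    by (intro hopf_intros word_lin clinear_bilinear_left[OF act])
  have unit: "?T a 1 = counit H a *\<^sub>C 1" for a
    using pure[of H a "[]"] by (simp add: one_tensor_algebra_def)
  have word_one: "?w vs 1 = pure_tensor vs" for vs
  proof (induction vs)
    case (Cons v vs)
    have "?w (v # vs) 1 = tensor_incl (act 1 v) * ?w vs 1"
      by (simp add: comult_one one_tensor_def tensor_lift_tensor[OF bil])
    then show ?case by (simp add: Cons hmodule.act_one[OF assms] pure_tensor_Cons)
  qed (simp add: counit_one scaleC_one one_tensor_algebra_def)
  have word_mult: "?w vs (a * b) = ?T a (?w vs b)" for vs a b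
  proof (induction vs arbitrary: a b)
    case Nil
    then show ?case
      by (simp add: clinear_scaleC[OF lin] unit counit_mult scaleC_scaleC mult.commute)
  next
    case (Cons v vs)
    have "?T a (?w (v # vs) b)
        = tensor_lift (\<lambda>b c. tensor_lift (\<lambda>a d. tensor_incl (act (a * b) v) * ?w vs (d * c)) (comult H a))
            (comult H b)"
      by (simp add: clinear_tensor_lift_commute[OF lin] tensor_algebra_act_times[OF assms]
          tensor_algebra_act_incl[OF assms] hmodule.act_mult[OF assms] Cons)
    also have "\<dots> = ?w (v # vs) (a * b)"
      by (simp add: comult_mult tensor_lift_mult[OF bil]) (rule tensor_lift_swap)
    finally show ?case ..
  qed
  show ?thesis
  proof unfold_locales
    show "bilinear_map ?T" by (rule bilinear_tensor_algebra_act[OF assms])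
    show "?T 1 x = x" for x
      by (rule clinear_eq_on_pure_tensors[where f = "?T 1" and g = "\<lambda>x. x"])
        (simp_all add: lin clinear_ident pure word_one)
    show "?T (a * b) x = ?T a (?T b x)" for a b x
      by (rule clinear_eq_on_pure_tensors[where g = "\<lambda>x. ?T a (?T b x)"])
        (simp_all add: lin clinear_compose[OF lin] pure word_mult)
  qed (simp_all add: tensor_algebra_act_times[OF assms] unit)
qed

end

section \<open>The star on the tensor algebra\<close>

lemma clinear_Bar_add: "clinear f \<Longrightarrow> f (Bar (x + y)) = f (Bar x) + f (Bar y)"
  using clinear_add[of f "Bar x" "Bar y"] by (simp add: plus_conjugate_def)

lemma clinear_Bar_scaleC: "clinear f \<Longrightarrow> f (Bar (c *\<^sub>C x)) = cnj c *\<^sub>C f (Bar x)"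
  using clinear_scaleC[of f "cnj c" "Bar x"] by (simp add: scaleC_conjugate_def)

lemma clinear_eq_on_Bar_pure_tensors:
  assumes "clinear f" "clinear g"
    and "\<And>vs. f (Bar (pure_tensor vs)) = g (Bar (pure_tensor vs))"
  shows "f x = g x"
proof -
  have "f (Bar t) = g (Bar t)" for t
  proof (induction t rule: tensor_algebra_induct)
    case zero
    show ?case
      using clinear_zero[OF assms(1)] clinear_zero[OF assms(2)] by (simp add: zero_conjugate_def)
  qed (simp_all add: assms clinear_Bar_add clinear_Bar_scaleC)
  from this[of "unbar x"] show ?thesis by simp
qed

lemma clinear_conj_act:
  assumes "\<And>b. clinear (act b)"
  shows "clinear (conj_act H act a)"
  by (rule clinearI)
    (simp_all add: conj_act_def plus_conjugate_def scaleC_conjugate_def clinear_add[OF assms]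
      clinear_scaleC[OF assms])

text \<open>The universal property yields linear maps, so the antilinear map \<open>v\<^sub>1 \<otimes> \<dots> \<otimes> v\<^sub>n \<mapsto> v\<^sub>n\<^sup>* \<otimes> \<dots> \<otimes> v\<^sub>1\<^sup>*\<close>
  is obtained by taking values in the conjugate space.\<close>

definition word_star ::
    "('v::complex_vector conjugate \<Rightarrow> 'v) \<Rightarrow> 'v tensor_algebra conjugate \<Rightarrow> 'v tensor_algebra" where
  "word_star star x =
     unbar (tensor_algebra_lift (\<lambda>vs. Bar (pure_tensor (map (\<lambda>v. star (Bar v)) (rev vs)))) (unbar x))"

context
  fixes star :: "'v::complex_vector conjugate \<Rightarrow> 'v"
  assumes star: "clinear star"
begin

lemma multilinear_word_star:
  "multilinear (\<lambda>vs. Bar (pure_tensor (map (\<lambda>v. star (Bar v)) (rev vs))))"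
  using multilinear_pure_tensor[where 'a = 'v]
  by (simp add: multilinear_iff clinear_Bar_add[OF star] clinear_Bar_scaleC[OF star]
      plus_conjugate_def scaleC_conjugate_def)

lemma word_star_pure_tensor:
  "word_star star (Bar (pure_tensor vs)) = pure_tensor (map (\<lambda>v. star (Bar v)) (rev vs))"
  by (simp add: word_star_def tensor_algebra_lift_pure[OF multilinear_word_star])

lemma clinear_word_star: "clinear (word_star star)"
  using clinear_tensor_algebra_lift[OF multilinear_word_star]
  by (simp add: word_star_def clinear_iff plus_conjugate_def scaleC_conjugate_def)

lemma word_star_incl: "word_star star (Bar (tensor_incl v)) = tensor_incl (star (Bar v))"
  by (simp add: tensor_incl_def word_star_pure_tensor)

lemma word_star_one: "word_star star 1 = 1"
  using word_star_pure_tensor[of "[]"] by (simp add: one_tensor_algebra_def one_conjugate_def)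

lemma word_star_times: "word_star star (x * y) = word_star star x * word_star star y"
proof (rule clinear_eq_on_Bar_pure_tensors[where f = "\<lambda>x. word_star star (x * y)"])
  note lin = clinear_word_star clinear_compose[OF clinear_word_star]
  show "clinear (\<lambda>x. word_star star (x * y))" "clinear (\<lambda>x. word_star star x * word_star star y)"
    by (intro clinear_intros lin)+
  fix us :: "'v list"
  let ?x = "Bar (pure_tensor us)"
  show "word_star star (?x * y) = word_star star ?x * word_star star y"
  proof (rule clinear_eq_on_Bar_pure_tensors[where f = "\<lambda>y. word_star star (?x * y)"])
    show "clinear (\<lambda>y. word_star star (?x * y))"
      "clinear (\<lambda>y. word_star star ?x * word_star star y)"
      by (intro clinear_intros lin)+
    show "word_star star (?x * Bar (pure_tensor vs))
        = word_star star ?x * word_star star (Bar (pure_tensor vs))" for vs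
      by (simp add: times_conjugate_def pure_tensor_mult word_star_pure_tensor)
  qed
qed

lemma word_star_word_star:
  assumes "star \<circ> conj_map star = unbar2"
  shows "word_star star \<circ> conj_map (word_star star) = unbar2"
proof
  fix x :: "'v tensor_algebra conjugate conjugate"
  have invol: "star (Bar (star (Bar v))) = v" for v
    using fun_cong[OF assms, of "Bar (Bar v)"] by (simp add: conj_map_def unbar2_def)
  have "word_star star (Bar (word_star star (Bar t))) = t" for t
  proof (rule clinear_eq_on_pure_tensors[where g = "\<lambda>t. t"])
    show "clinear (\<lambda>t. word_star star (Bar (word_star star (Bar t))))"
      by (rule clinearI)
        (simp_all add: clinear_Bar_add[OF clinear_word_star] clinear_Bar_scaleC[OF clinear_word_star])
    show "word_star star (Bar (word_star star (Bar (pure_tensor vs)))) = pure_tensor vs" for vs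
      by (simp add: word_star_pure_tensor rev_map comp_def invol)
  qed (rule clinear_ident)
  from this[of "unbar (unbar x)"] show "(word_star star \<circ> conj_map (word_star star)) x = unbar2 x"
    by (simp add: conj_map_def unbar2_def)
qed

end

text \<open>For a word \<open>v \<otimes> w\<close> the element \<open>S(a)\<^sup>*\<close> acts as \<open>S(a\<^sub>(\<^sub>2\<^sub>))\<^sup>* \<rhd> v \<otimes> S(a\<^sub>(\<^sub>1\<^sub>))\<^sup>* \<rhd> w\<close>, and the star
  turns this into \<open>a\<^sub>(\<^sub>1\<^sub>) \<rhd> w\<^sup>* \<otimes> a\<^sub>(\<^sub>2\<^sub>) \<rhd> v\<^sup>*\<close>.\<close>

lemma word_star_act:
  assumes H: "hopf_star_algebra H" and V: "star_module H act star"
  shows "word_star star (conj_act H (tensor_algebra_act H act) a x)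
    = tensor_algebra_act H act a (word_star star x)"
proof (rule clinear_eq_on_Bar_pure_tensors[where f = "\<lambda>x. word_star star (conj_act H _ a x)"])
  interpret hopf_star_algebra H by fact
  interpret star_module H act star by fact
  let ?T = "tensor_algebra_act H act" and ?st = "word_star star" and ?w = "word_act H act"
  let ?s = "\<lambda>a. hstar H (antipode H a)"
  have star: "clinear star" and star_act: "star (Bar (act (?s a) v)) = act a (star (Bar v))" for a v
    using star_structure
    by (auto simp: star_structure_def module_map_def conj_act_def dest!: spec[of _ "Bar v"])
  note st = clinear_word_star[OF star] and act = clinear_tensor_algebra_act[OF hmodule_axioms]
  note pure = tensor_algebra_act_pure[OF hmodule_axioms]
  show "clinear (\<lambda>x. ?st (conj_act H ?T a x))" "clinear (\<lambda>x. ?T a (?st x))"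
    by (rule clinear_compose[OF st clinear_conj_act[OF act]] clinear_compose[OF act st])+
  fix vs
  have "?st (Bar (?w vs (?s a))) = ?T a (?st (Bar (pure_tensor vs)))" for a
  proof (induction vs arbitrary: a)
    case Nil
    have "?T a 1 = counit H a *\<^sub>C 1"
      using pure[of H a "[]"] by (simp add: one_tensor_algebra_def)
    moreover have "?st (Bar 1) = 1"
      using word_star_one[OF star] by (simp add: one_conjugate_def)
    ultimately show ?case
      by (simp add: clinear_Bar_scaleC[OF st] counit_hstar counit_antipode
          flip: one_tensor_algebra_def)
  next
    case (Cons v vs)
    have bil: "bilinear_map (\<lambda>b c. tensor_incl (act b v) * ?w vs c)"
      by (intro hopf_intros clinear_bilinear_left[OF bilinear_act]
          clinear_compose[OF clinear_word_act[OF hopf_algebra_axioms hmodule_axioms]])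
    have cons: "?st (Bar (tensor_incl u * y)) = ?st (Bar y) * tensor_incl (star (Bar u))" for u y
      using word_star_times[OF star, of "Bar y" "Bar (tensor_incl u)"]
      by (simp add: times_conjugate_def word_star_incl[OF star])
    have "?st (Bar (?w (v # vs) (?s a)))
        = tensor_lift (\<lambda>b c. ?st (Bar (tensor_incl (act (?s c) v) * ?w vs (?s b)))) (comult H a)"
      by (simp add: tensor_lift_comult_hstar_antipode[OF bil] clinear_tensor_lift_commute[OF st])
    also have "\<dots> = tensor_lift (\<lambda>b c. ?T b (?st (Bar (pure_tensor vs))) * ?T c (tensor_incl (star (Bar v))))
        (comult H a)"
      by (simp add: cons Cons star_act tensor_algebra_act_incl[OF hmodule_axioms])
    also have "\<dots> = ?T a (?st (Bar (pure_tensor (v # vs))))"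
      by (simp add: tensor_algebra_act_times[OF hmodule_axioms] pure_tensor_Cons cons)
    finally show ?case .
  qed
  then show "?st (conj_act H ?T a (Bar (pure_tensor vs))) = ?T a (?st (Bar (pure_tensor vs)))"
    by (simp add: conj_act_def pure)
qed

lemma star_module_algebra_word_star:
  assumes "hopf_star_algebra H" "star_module H act star"
  shows "star_module_algebra H (tensor_algebra_act H act) (word_star star)"
proof -
  interpret hopf_star_algebra H by fact
  interpret star_module H act star by fact
  interpret T: hmodule_algebra H "tensor_algebra_act H act"
    by (rule hmodule_algebra_tensor_algebra[OF hmodule_axioms])
  have star: "clinear star" "star \<circ> conj_map star = unbar2"
    using star_structure by (auto simp: star_structure_def module_map_def)
  show ?thesis
    by unfold_locales
      (simp_all add: star_structure_def module_map_def clinear_word_star word_star_act[OF assms]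
        word_star_word_star word_star_times word_star_one star)
qed

text \<open>A word is the product of its letters, and a star reverses products.\<close>

lemma star_module_algebra_pure_tensor:
  assumes "star_module_algebra H act' st"
    and incl: "\<And>v. st (Bar (tensor_incl v)) = tensor_incl (star (Bar v))"
  shows "st (Bar (pure_tensor vs)) = pure_tensor (map (\<lambda>v. star (Bar v)) (rev vs))"
proof (induction vs)
  interpret star_module_algebra H act' st by fact
  case Nil
  show ?case using star_one by (simp add: one_tensor_algebra_def one_conjugate_def)
next
  interpret star_module_algebra H act' st by fact
  case (Cons v vs)
  have "st (Bar (pure_tensor (v # vs))) = st (Bar (pure_tensor vs)) * st (Bar (tensor_incl v))"
    using star_times[of "Bar (pure_tensor vs)" "Bar (tensor_incl v)"]
    by (simp add: times_conjugate_def pure_tensor_Cons)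
  then show ?case by (simp add: Cons incl) (simp add: tensor_incl_def pure_tensor_mult)
qed

section \<open>Restriction to the tensor powers\<close>

lemma subspace_tensor_power: "complex_vector.subspace (tensor_power n)"
  unfolding tensor_power_def by (rule complex_vector.subspace_span)

lemma pure_tensor_in_power: "pure_tensor vs \<in> tensor_power (length vs)"
  unfolding tensor_power_def by (rule complex_vector.span_base) auto

lemma tensor_incl_mult_in_power:
  assumes "y \<in> tensor_power n"
  shows "tensor_incl v * y \<in> tensor_power (Suc n)"
  using assms unfolding tensor_power_def
proof (induction rule: complex_vector.span_induct_alt)
  case base
  show ?case by (simp add: complex_vector.span_zero)
next
  case (step c x y)
  then obtain vs where "x = pure_tensor vs" "length vs = n" by auto
  then have "tensor_incl v * x \<in> complex_vector.span (pure_tensor ` {vs. length vs = Suc n})"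
    by (intro complex_vector.span_base) (auto simp flip: pure_tensor_Cons)
  then show ?case
    using step by (simp add: distrib_left scaleC_mult_right complex_vector.span_add
        complex_vector.span_scale)
qed

lemma word_act_in_power: "word_act H act vs a \<in> tensor_power (length vs)"
proof (induction vs arbitrary: a)
  case Nil
  show ?case by (auto simp: tensor_power_0)
next
  case (Cons v vs)
  then show ?case
    by (simp add: tensor_lift_in_subspace subspace_tensor_power tensor_incl_mult_in_power)
qed

lemma tensor_algebra_act_in_power:
  assumes "hmodule act" "x \<in> tensor_power n"
  shows "tensor_algebra_act H act a x \<in> tensor_power n"
  using assms(2)
  unfolding tensor_power_def[of n]
proof (induction rule: complex_vector.span_induct_alt)
  case base
  show ?case
    by (simp add: clinear_zero[OF clinear_tensor_algebra_act[OF assms(1)]]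
        complex_vector.span_zero)
next
  case (step c x y)
  then have "tensor_algebra_act H act a x \<in> tensor_power n"
    using word_act_in_power[of H act _ a] by (auto simp: tensor_algebra_act_pure[OF assms(1)])
  then show ?case
    using step
    by (simp add: tensor_power_def clinear_add[OF clinear_tensor_algebra_act[OF assms(1)]]
        clinear_scaleC[OF clinear_tensor_algebra_act[OF assms(1)]]
        complex_vector.span_add complex_vector.span_scale)
qed

lemma star_in_power:
  assumes "clinear st"
    and pure: "\<And>vs. st (Bar (pure_tensor vs)) = pure_tensor (map f (rev vs))"
    and "x \<in> tensor_power n"
  shows "st (Bar x) \<in> tensor_power n"
  using assms(3)
  unfolding tensor_power_def[of n]
proof (induction rule: complex_vector.span_induct_alt)
  case base
  show ?case
    using clinear_zero[OF assms(1)] by (simp add: zero_conjugate_def complex_vector.span_zero)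
next
  case (step c x y)
  then have "st (Bar x) \<in> tensor_power n"
    using pure_tensor_in_power[of "map f (rev _)"] by (auto simp: pure)
  then show ?case
    using step
    by (simp add: tensor_power_def clinear_Bar_add[OF assms(1)] clinear_Bar_scaleC[OF assms(1)]
        complex_vector.span_add complex_vector.span_scale)
qed

lemma star_structure_on_tensor_power:
  assumes "hmodule act" and st: "star_structure H (tensor_algebra_act H act) st"
    and pure: "\<And>vs. st (Bar (pure_tensor vs)) = pure_tensor (map f (rev vs))"
  shows "star_structure_on (tensor_power n) H (tensor_algebra_act H act) st"
proof -
  have "clinear st" using st by (simp add: star_structure_def module_map_def)
  note power = star_in_power[OF this pure]
  show ?thesis
    using st unfolding star_structure_on_UNIV[symmetric] star_structure_on_def
    by (auto simp: subspace_tensor_power tensor_algebra_act_in_power[OF assms(1)] power)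
qed

lemma direct_sum_star_restrictions:
  fixes st :: "'v::complex_vector tensor_algebra conjugate \<Rightarrow> 'v tensor_algebra"
  assumes "clinear st"
  shows "direct_sum_star (\<lambda>n. st) = st"
proof
  fix x :: "'v tensor_algebra conjugate"
  have lin: "clinear (\<lambda>y. Bar (st (Bar y)))"
    using assms
    by (intro clinearI)
      (simp_all add: clinear_Bar_add clinear_Bar_scaleC plus_conjugate_def scaleC_conjugate_def)
  let ?A = "{n. tensor_component n (unbar x) \<noteq> 0}"
  have Bar_sum: "(\<Sum>n\<in>A. Bar (g n)) = Bar (sum g A)" for g :: "nat \<Rightarrow> 'v tensor_algebra" and A
    by (induction A rule: infinite_finite_induct) (simp_all add: zero_conjugate_def plus_conjugate_def)
  have "Bar (st x) = Bar (st (Bar (\<Sum>n\<in>?A. tensor_component n (unbar x))))"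
    by (simp flip: tensor_components_sum)
  also have "\<dots> = (\<Sum>n\<in>?A. Bar (st (Bar (tensor_component n (unbar x)))))"
    by (rule clinear_sum[OF lin])
  also have "\<dots> = Bar (\<Sum>n\<in>?A. st (Bar (tensor_component n (unbar x))))"
    by (rule Bar_sum)
  finally show "direct_sum_star (\<lambda>n. st) x = st x" by (simp add: direct_sum_star_def)
qed

theorem proposition7p6:
  fixes H :: "'h::complex_algebra hopf_data"
    and act :: "'h \<Rightarrow> 'v::complex_vector \<Rightarrow> 'v"
    and star :: "'v conjugate \<Rightarrow> 'v"
  assumes "hopf_star_algebra H"
    and "star_module H act star"
  shows
    "(\<exists>!st. star_module_algebra H (tensor_algebra_act H act) st \<and>
        star_module_morphism act star (tensor_algebra_act H act) st tensor_incl) \<and>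
     (\<forall>st. star_module_algebra H (tensor_algebra_act H act) st \<longrightarrow>
        (star_module_morphism act star (tensor_algebra_act H act) st tensor_incl \<longleftrightarrow>
         st \<circ> conj_map tensor_incl = tensor_incl \<circ> star)) \<and>
     (\<forall>st. star_module_algebra H (tensor_algebra_act H act) st \<and>
        star_module_morphism act star (tensor_algebra_act H act) st tensor_incl \<longrightarrow>
        (\<forall>vs. st (Bar (pure_tensor vs)) = pure_tensor (map (\<lambda>v. star (Bar v)) (rev vs))) \<and>
        (\<exists>s. (\<forall>n. star_structure_on (tensor_power n) H (tensor_algebra_act H act) (s n) \<and>
                (\<forall>vs. length vs = n \<longrightarrow>
                  s n (Bar (pure_tensor vs)) = pure_tensor (map (\<lambda>v. star (Bar v)) (rev vs)))) \<and>
             (\<forall>c. s 0 (Bar (c *\<^sub>C 1)) = cnj c *\<^sub>C 1) \<and>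
             st = direct_sum_star s))"
proof -
  interpret hopf_star_algebra H by fact
  interpret star_module H act star by fact
  let ?T = "tensor_algebra_act H act"
  have star: "clinear star" using star_structure by (simp add: star_structure_def module_map_def)
  have module_map: "module_map act ?T tensor_incl"
    by (simp add: module_map_def clinear_incl tensor_algebra_act_incl[OF hmodule_axioms])
  have morphism: "star_module_morphism act star ?T st tensor_incl
      \<longleftrightarrow> st \<circ> conj_map tensor_incl = tensor_incl \<circ> star" for st
    using module_map by (auto simp: star_module_morphism_def star_map_def)
  have pure: "st (Bar (pure_tensor vs)) = pure_tensor (map (\<lambda>v. star (Bar v)) (rev vs))"
    if "star_module_algebra H ?T st" "star_module_morphism act star ?T st tensor_incl" for st vs
  proof (rule star_module_algebra_pure_tensor[OF that(1)])
    show "st (Bar (tensor_incl v)) = tensor_incl (star (Bar v))" for v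
      using that(2) by (auto simp: morphism fun_eq_iff conj_map_def dest!: spec[of _ "Bar v"])
  qed
  have star_struct: "star_structure H ?T st" and linear: "clinear st"
    if "star_module_algebra H ?T st" for st
  proof -
    interpret star_module_algebra H ?T st by fact
    show "star_structure H ?T st" by (rule star_structure)
    then show "clinear st" by (simp add: star_structure_def module_map_def)
  qed
  show ?thesis
  proof (intro conjI allI impI; (elim conjE)?)
    show "\<exists>!st. star_module_algebra H ?T st \<and> star_module_morphism act star ?T st tensor_incl"
    proof (intro ex1I conjI; (elim conjE)?)
      show "star_module_algebra H ?T (word_star star)"
        by (rule star_module_algebra_word_star[OF assms])
      show "star_module_morphism act star ?T (word_star star) tensor_incl"
        unfolding morphism
        by (simp add: fun_eq_iff conj_map_def word_star_incl[OF star])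
      fix st
      assume "star_module_algebra H ?T st" "star_module_morphism act star ?T st tensor_incl"
      note st = this
      have "st x = word_star star x" for x
        by (rule clinear_eq_on_Bar_pure_tensors[OF linear[OF st(1)] clinear_word_star[OF star]])
          (simp add: pure[OF st] word_star_pure_tensor[OF star])
      then show "st = word_star star" by (rule ext)
    qed
  next
    fix st
    show "star_module_morphism act star ?T st tensor_incl
      \<longleftrightarrow> st \<circ> conj_map tensor_incl = tensor_incl \<circ> star" by (rule morphism)
  next
    fix st vs
    assume "star_module_algebra H ?T st" "star_module_morphism act star ?T st tensor_incl"
    then show "st (Bar (pure_tensor vs)) = pure_tensor (map (\<lambda>v. star (Bar v)) (rev vs))"
      by (rule pure)
  next
    fix st
    assume st: "star_module_algebra H ?T st" "star_module_morphism act star ?T st tensor_incl"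
    have "st (Bar (c *\<^sub>C 1)) = cnj c *\<^sub>C 1" for c
      using pure[OF st, of "[]"]
      by (simp add: clinear_Bar_scaleC[OF linear[OF st(1)]] one_tensor_algebra_def)
    \<comment> \<open>The restriction of \<open>st\<close> to the conjugate of \<open>tensor_power n\<close> is represented by the total
      function \<open>st\<close> itself.\<close>
    then show "\<exists>s. (\<forall>n. star_structure_on (tensor_power n) H ?T (s n) \<and>
              (\<forall>vs. length vs = n \<longrightarrow>
                s n (Bar (pure_tensor vs)) = pure_tensor (map (\<lambda>v. star (Bar v)) (rev vs)))) \<and>
           (\<forall>c. s 0 (Bar (c *\<^sub>C 1)) = cnj c *\<^sub>C 1) \<and> st = direct_sum_star s"
      by (intro exI[of _ "\<lambda>n. st"])
        (simp add: star_structure_on_tensor_power[OF hmodule_axioms star_struct[OF st(1)] pure[OF st]]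
          pure[OF st] direct_sum_star_restrictions[OF linear[OF st(1)]])
  qed
qed

end
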